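(* Let $\varepsilon\in(0,1)$, let $B(n)$ be a number such that $K_n\le B(n)$, and assume that the number $M$ of offline samples satisfies $$M\ge\gamma\,B(n)\,\ln(2n/\varepsilon).$$ Then, under the sampling budget condition $$m\ge 3\,\gamma\,n\,\ln(2n/\varepsilon)$$ for the online stage, the event $E:=\{\|G-I\|_2\le\frac12\ \text{and}\ \|G_M-I\|_2\le\frac12\}$ satisfies $\Pr(E^c)\le 2\varepsilon$. In addition, for every $u\in L^2(D,\mu)$, one has the convergence bound $$\mathbb E\left(\|u-\widetilde u_n\|^2\,\chi_E\right)\le(1+\eta(m))\,e_n(u)^2,$$ and, if $\|u\|_{L^\infty(D)}\le\tau$, $$\mathbb E\left(\|u-\widetilde u_n^T\|^2\right)\le(1+\eta(m))\,e_n(u)^2+8\,\varepsilon\,\tau^2,$$ where $\eta(m)=12\,\frac nm\le\frac{4}{\gamma\ln(2n/\varepsilon)}$.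
   Context: Setting. $D\subset\mathbb R^d$, $\mu$ is a probability measure on $D$, $\|\cdot\|$ is the norm of $L^2(D,\mu)$, and $V_n\subset L^2(D,\mu)$ is an $n$-dimensional linear space of real-valued functions defined pointwise on $D$. Let $(L_1,\dots,L_n)$ be an $L^2(D,\mu)$-orthonormal basis of $V_n$, $k_n(x)=\sum_{j=1}^n|L_j(x)|^2$ and $K_n=\sup_{x\in D}k_n(x)$. Put $e_n(u)=\min_{v\in V_n}\|u-v\|$ and $\gamma=\left(\frac32\ln\frac32-\frac12\right)^{-1}$. $\|\cdot\|_2$ is the spectral norm of matrices and $\chi_E$ the indicator of the event $E$. Offline stage. Points $z^1,\dots,z^M$ are drawn independently according to $\mu$. With $\langle u,v\rangle_M=\frac1M\sum_{i=1}^M u(z^i)v(z^i)$, let $G_M=(\langle L_j,L_k\rangle_M)_{j,k=1,\dots,n}$ and let $(\widetilde L_1,\dots,\widetilde L_n)$ be an orthonormal basis of $V_n$ for $\langle\cdot,\cdot\rangle_M$. Define $\widetilde k_n=\sum_{j=1}^n|\widetilde L_j|^2$ and the probability measure $d\widetilde\sigma=\alpha\,\frac{\widetilde k_n}{n}\,d\mu$, where $\alpha$ is the normalization factor such that $\alpha\int_D\widetilde k_n\,d\mu=n$. (On the event that $\langle\cdot,\cdot\rangle_M$ is not an inner product on $V_n$, which is contained in $E^c$, the sampling measure and $\widetilde u_n\in V_n$ may be chosen arbitrarily.) Online stage. Given the $z^i$, points $x^1,\dots,x^m$ are drawn independently according to $\widetilde\sigma$. Let $\widetilde w=\frac{n}{\alpha\widetilde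 k_n}$ (defined where $\widetilde k_n>0$), $\langle u,v\rangle_m=\frac1m\sum_{i=1}^m\widetilde w(x^i)u(x^i)v(x^i)$ and $G=(\langle L_j,L_k\rangle_m)_{j,k=1,\dots,n}$. The estimator $\widetilde u_n\in V_n$ is a solution of $\min_{v\in V_n}\sum_{i=1}^m\widetilde w(x^i)|u(x^i)-v(x^i)|^2$ (unique when $G$ is nonsingular). For $\tau>0$, $\widetilde u_n^T=T_\tau\circ\widetilde u_n$ with $T_\tau(y)=\min\{\tau,|y|\}\,\mathrm{sgn}(y)$. $\Pr$ and $\mathbb E$ refer to both draws. *)

theory Defs
  imports "HOL-Probability.Probability"
begin

section \<open>The space \<open>L\<^sup>2(D,\<mu>)\<close> and finite-dimensional subspaces\<close>

text \<open>
  Elements of \<open>L\<^sup>2(D,\<mu>)\<close> are represented by functions, not by classes modulo null sets,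
  because they are evaluated at the sample points.  Functions on \<open>D\<close> are total functions
  whose values outside \<open>D = space \<mu>\<close> never matter.
\<close>

definition L2_space :: "'a measure \<Rightarrow> ('a \<Rightarrow> real) set" where
  "L2_space \<mu> = {f \<in> borel_measurable \<mu>. integrable \<mu> (\<lambda>x. (f x)\<^sup>2)}"

definition L2_inner :: "'a measure \<Rightarrow> ('a \<Rightarrow> real) \<Rightarrow> ('a \<Rightarrow> real) \<Rightarrow> real" where
  "L2_inner \<mu> f g = (\<integral>x. f x * g x \<partial>\<mu>)"

definition L2_norm :: "'a measure \<Rightarrow> ('a \<Rightarrow> real) \<Rightarrow> real" where
  "L2_norm \<mu> f = sqrt (\<integral>x. (f x)\<^sup>2 \<partial>\<mu>)"

definition fun_span :: "('n::finite \<Rightarrow> 'a \<Rightarrow> real) \<Rightarrow> ('a \<Rightarrow> real) set" where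
  "fun_span L = range (\<lambda>c :: 'n \<Rightarrow> real. \<lambda>x. \<Sum>j\<in>UNIV. c j * L j x)"

definition orthonormal_basis ::
  "(('a \<Rightarrow> real) \<Rightarrow> ('a \<Rightarrow> real) \<Rightarrow> real) \<Rightarrow> ('a \<Rightarrow> real) set \<Rightarrow> ('n::finite \<Rightarrow> 'a \<Rightarrow> real) \<Rightarrow> bool"
where
  "orthonormal_basis ip V L \<longleftrightarrow>
     V = fun_span L \<and> (\<forall>j k. ip (L j) (L k) = (if j = k then 1 else 0))"

text \<open>
  The forms to which this is applied are symmetric, bilinear and positive semidefinite by
  construction, so definiteness is all that is needed for an inner product.
\<close>

definition inner_product_on ::
  "('a \<Rightarrow> real) set \<Rightarrow> (('a \<Rightarrow> real) \<Rightarrow> ('a \<Rightarrow> real) \<Rightarrow> real) \<Rightarrow> bool"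
where
  "inner_product_on V ip \<longleftrightarrow> (\<forall>v\<in>V. v \<noteq> (\<lambda>_. 0) \<longrightarrow> 0 < ip v v)"

definition christoffel :: "('n::finite \<Rightarrow> 'a \<Rightarrow> real) \<Rightarrow> 'a \<Rightarrow> real" where
  "christoffel L x = (\<Sum>j\<in>UNIV. (L j x)\<^sup>2)"

text \<open>The minimum is attained for finite-dimensional \<open>V\<close>, so the infimum is the minimum.\<close>

definition best_error :: "'a measure \<Rightarrow> ('a \<Rightarrow> real) set \<Rightarrow> ('a \<Rightarrow> real) \<Rightarrow> real" where
  "best_error \<mu> V u = (INF v\<in>V. L2_norm \<mu> (\<lambda>x. u x - v x))"

definition gram ::
  "(('a \<Rightarrow> real) \<Rightarrow> ('a \<Rightarrow> real) \<Rightarrow> real) \<Rightarrow> ('n::finite \<Rightarrow> 'a \<Rightarrow> real) \<Rightarrow> real^'n^'n"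
where
  "gram ip L = (\<chi> j k. ip (L j) (L k))"

definition spectral_norm :: "real^'n^'n \<Rightarrow> real" where
  "spectral_norm A = onorm (\<lambda>v. A *v v)"

definition gamma_const :: real where
  "gamma_const = inverse (3/2 * ln (3/2) - 1/2)"

definition trunc :: "real \<Rightarrow> real \<Rightarrow> real" where
  "trunc \<tau> y = min \<tau> \<bar>y\<bar> * sgn y"


section \<open>Offline and online sampling\<close>

definition offline_ip :: "nat \<Rightarrow> (nat \<Rightarrow> 'a) \<Rightarrow> ('a \<Rightarrow> real) \<Rightarrow> ('a \<Rightarrow> real) \<Rightarrow> real" where
  "offline_ip M z f g = (\<Sum>i\<in>{1..M}. f (z i) * g (z i)) / real M"

definition online_ip ::
  "nat \<Rightarrow> ('a \<Rightarrow> real) \<Rightarrow> (nat \<Rightarrow> 'a) \<Rightarrow> ('a \<Rightarrow> real) \<Rightarrow> ('a \<Rightarrow> real) \<Rightarrow> real"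
where
  "online_ip m w x f g = (\<Sum>i\<in>{1..m}. w (x i) * f (x i) * g (x i)) / real m"

text \<open>In the next three definitions the argument is the empirical orthonormal basis.\<close>

definition norm_factor :: "'a measure \<Rightarrow> ('n::finite \<Rightarrow> 'a \<Rightarrow> real) \<Rightarrow> real" where
  "norm_factor \<mu> Lt = real CARD('n) / (\<integral>x. christoffel Lt x \<partial>\<mu>)"

definition sampling_measure :: "'a measure \<Rightarrow> ('n::finite \<Rightarrow> 'a \<Rightarrow> real) \<Rightarrow> 'a measure" where
  "sampling_measure \<mu> Lt =
     density \<mu> (\<lambda>x. ennreal (norm_factor \<mu> Lt * christoffel Lt x / real CARD('n)))"

text \<open>
  The convention \<open>1 / 0 = 0\<close> gives the weight the value \<open>0\<close> where the Christoffel
  function vanishes, which is a null set for the sampling measure.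
\<close>

definition weight :: "'a measure \<Rightarrow> ('n::finite \<Rightarrow> 'a \<Rightarrow> real) \<Rightarrow> 'a \<Rightarrow> real" where
  "weight \<mu> Lt x = real CARD('n) / (norm_factor \<mu> Lt * christoffel Lt x)"

definition iid_samples :: "nat \<Rightarrow> 'a measure \<Rightarrow> (nat \<Rightarrow> 'a) measure" where
  "iid_samples N \<nu> = PiM {1..N} (\<lambda>_. \<nu>)"

text \<open>
  Joint law of \<open>(z, x)\<close>: first \<open>z\<^sup>1,\<dots>,z\<^sup>M\<close> i.i.d. from \<open>\<mu>\<close>, then, given \<open>z\<close>,
  \<open>x\<^sup>1,\<dots>,x\<^sup>m\<close> i.i.d. from \<open>\<sigma> z\<close>.
\<close>

definition two_stage_law ::
  "'a measure \<Rightarrow> nat \<Rightarrow> nat \<Rightarrow> ((nat \<Rightarrow> 'a) \<Rightarrow> 'a measure)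
     \<Rightarrow> ((nat \<Rightarrow> 'a) \<times> (nat \<Rightarrow> 'a)) measure"
where
  "two_stage_law \<mu> M m \<sigma> =
     Giry_Monad.bind (iid_samples M \<mu>)
       (\<lambda>z. distr (iid_samples m (\<sigma> z)) (iid_samples M \<mu> \<Otimes>\<^sub>M iid_samples m \<mu>) (\<lambda>x. (z, x)))"

text \<open>
  \<open>Lt z\<close> is an orthonormal basis of \<open>V\<close> for the empirical inner product whenever the latter
  is an inner product on \<open>V\<close>, and arbitrary otherwise.
\<close>

definition offline_basis ::
  "'a measure \<Rightarrow> ('a \<Rightarrow> real) set \<Rightarrow> nat \<Rightarrow> ((nat \<Rightarrow> 'a) \<Rightarrow> 'n::finite \<Rightarrow> 'a \<Rightarrow> real) \<Rightarrow> bool"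
where
  "offline_basis \<mu> V M Lt \<longleftrightarrow>
     (\<forall>z \<in> space (iid_samples M \<mu>). inner_product_on V (offline_ip M z) \<longrightarrow>
        orthonormal_basis (offline_ip M z) V (Lt z))"

text \<open>
  The online sampling measure is a probability kernel.  The kernel property is only
  a requirement on the arbitrary choice made on the degenerate event, since the Christoffel
  function, and hence the density, depends on the offline inner product only and not on
  the choice of \<open>Lt z\<close>.
\<close>

definition online_kernel ::
  "'a measure \<Rightarrow> ('a \<Rightarrow> real) set \<Rightarrow> nat \<Rightarrow> ((nat \<Rightarrow> 'a) \<Rightarrow> 'n::finite \<Rightarrow> 'a \<Rightarrow> real)
     \<Rightarrow> ((nat \<Rightarrow> 'a) \<Rightarrow> 'a measure) \<Rightarrow> bool"
where
  "online_kernel \<mu> V M Lt \<sigma> \<longleftrightarrow>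
     \<sigma> \<in> iid_samples M \<mu> \<rightarrow>\<^sub>M prob_algebra \<mu> \<and>
     (\<forall>z \<in> space (iid_samples M \<mu>). inner_product_on V (offline_ip M z) \<longrightarrow>
        \<sigma> z = sampling_measure \<mu> (Lt z))"

definition least_squares_estimator ::
  "'a measure \<Rightarrow> ('a \<Rightarrow> real) set \<Rightarrow> nat \<Rightarrow> nat \<Rightarrow> ((nat \<Rightarrow> 'a) \<Rightarrow> 'n::finite \<Rightarrow> 'a \<Rightarrow> real)
     \<Rightarrow> ('a \<Rightarrow> real) \<Rightarrow> ((nat \<Rightarrow> 'a) \<times> (nat \<Rightarrow> 'a) \<Rightarrow> 'a \<Rightarrow> real) \<Rightarrow> bool"
where
  "least_squares_estimator \<mu> V M m Lt u ut \<longleftrightarrow>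
     (\<forall>z \<in> space (iid_samples M \<mu>). \<forall>x \<in> space (iid_samples m \<mu>).
        ut (z, x) \<in> V \<and>
        (inner_product_on V (offline_ip M z) \<longrightarrow>
           is_arg_min (\<lambda>v. \<Sum>i\<in>{1..m}. weight \<mu> (Lt z) (x i) * \<bar>u (x i) - v (x i)\<bar>\<^sup>2)
             (\<lambda>v. v \<in> V) (ut (z, x))))"

definition stable_event ::
  "'a measure \<Rightarrow> nat \<Rightarrow> nat \<Rightarrow> ('n::finite \<Rightarrow> 'a \<Rightarrow> real)
     \<Rightarrow> ((nat \<Rightarrow> 'a) \<Rightarrow> 'n \<Rightarrow> 'a \<Rightarrow> real) \<Rightarrow> ((nat \<Rightarrow> 'a) \<times> (nat \<Rightarrow> 'a)) set"
where
  "stable_event \<mu> M m L Lt =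
     {(z, x) \<in> space (iid_samples M \<mu> \<Otimes>\<^sub>M iid_samples m \<mu>).
        spectral_norm (gram (online_ip m (weight \<mu> (Lt z)) x) L - mat 1) \<le> 1/2 \<and>
        spectral_norm (gram (offline_ip M z) L - mat 1) \<le> 1/2}"

end

theory Submission
  imports Defs
begin

text \<open>
  The probabilistic core is a matrix Chernoff inequality: if \<open>\<phi>\<close> is a random vector with
  \<open>\<bar>\<phi>\<bar>\<^sup>2 \<le> K\<close> and \<open>\<E> \<phi> \<phi>\<^sup>T = I\<close>, the empirical second moment of \<open>m\<close> independent copies
  is within \<open>1/2\<close> of the identity, up to a probability \<open>\<epsilon>\<close>, once \<open>m \<ge> \<gamma> K ln (2 n / \<epsilon>)\<close>
  (\<open>matrix_chernoff\<close>).  It is applied twice.  Offline, \<open>\<phi> = (L\<^sub>1, \<dots>, L\<^sub>n)\<close> under \<open>\<mu>\<close>, with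
  \<open>K = B\<close>.  Online, \<open>\<phi> = \<surd>w (L\<^sub>1, \<dots>, L\<^sub>n)\<close> under the sampling measure; the weight makes the second
  moment the identity again.  If the offline Gram matrix \<open>G\<^sub>M\<close> is within \<open>1/2\<close> of the identity, the
  empirical Christoffel function \<open>L(y)\<^sup>T G\<^sub>M\<^sup>-\<^sup>1 L(y)\<close> is at least \<open>2/3\<close> of the true one, and its
  integral, the trace of \<open>G\<^sub>M\<^sup>-\<^sup>1\<close>, is at most \<open>2 n\<close>; together these give \<open>K = 3 n\<close>
  (lemma \<open>w_christoffel_le\<close>).  Conditioning on the offline draw, the two failure
  probabilities add up to at most \<open>2 \<epsilon>\<close>.

  The matrix Chernoff inequality is obtained without matrix exponentials.  For \<open>N = 2\<^sup>k\<close> the exponential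
  of \<open>(t/m) \<Sum> \<phi>\<^sub>i \<phi>\<^sub>i\<^sup>T\<close> is replaced by the \<open>N\<close>-th power of the symmetric product of the factors
  \<open>I + t / (2 m N) \<phi>\<^sub>i \<phi>\<^sub>i\<^sup>T\<close>.  The role of the Golden-Thompson inequality is played by
  \<open>tr (A B)\<^sup>N \<le> tr A\<^sup>N B\<^sup>N\<close>, which for \<open>N\<close> a power of two follows from repeated use of the
  Cauchy-Schwarz inequality (lemma \<open>trace_dyadic_power_bounds\<close>).  Because all copies have the same
  distribution and second moment \<open>I\<close>, each sample multiplies the expected trace by at most a scalar, and the
  scalar Chernoff constants reappear as \<open>N \<rightarrow> \<infinity>\<close>.

  For the error bound, let \<open>g\<close> be the residual of the \<open>L\<^sup>2\<close> projection of \<open>u\<close>, so that its norm is the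
  best approximation error.  On the stable event the normal equations read \<open>G d = b\<close>, where \<open>d\<close> is the
  coefficient error and \<open>b\<close> the vector of the empirical products of \<open>g\<close> with the \<open>L\<^sub>j\<close>.  Since \<open>G\<close>
  is within \<open>1/2\<close> of the identity, \<open>\<bar>d\<bar>\<^sup>2 \<le> 4 \<bar>b\<bar>\<^sup>2\<close>.  Given a stable offline draw, \<open>b\<close> is an
  average of \<open>m\<close> independent centred terms, so \<open>\<E> \<bar>b\<bar>\<^sup>2\<close> is at most \<open>3 n / m\<close> times the squared best approximation error.
  Pythagoras' theorem gives the factor \<open>1 + 12 n / m\<close>.  Truncation cannot increase the error where
  \<open>\<bar>u\<bar> \<le> \<tau>\<close>, and it bounds the squared error by \<open>4 \<tau>\<^sup>2\<close> on the complement of the stable event, which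
  costs \<open>4 \<tau>\<^sup>2\<close> times \<open>2 \<epsilon>\<close>.
\<close>

section \<open>Traces of dyadic matrix powers\<close>

text \<open>
  The matrix \<open>A\<close> to the power \<open>2\<^sup>k\<close>.  The recursion squares the argument, because the trace
  inequalities below pass from \<open>A\<close> to \<open>A\<^sup>2\<close>.
\<close>

fun dyadic_power :: "nat \<Rightarrow> real^'n^'n \<Rightarrow> real^'n^'n" where
  "dyadic_power 0 A = A"
| "dyadic_power (Suc k) A = dyadic_power k (A ** A)"

lemma dyadic_power_Suc: "dyadic_power (Suc k) A = dyadic_power k A ** dyadic_power k A"
  by (induction k arbitrary: A) auto

lemma transpose_dyadic_power: "transpose (dyadic_power k A) = dyadic_power k (transpose A)"
  by (induction k arbitrary: A) (auto simp: matrix_transpose_mul)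

lemma trace_transpose: "trace (transpose A) = trace (A :: real^'n^'n)"
  by (simp add: trace_def transpose_def)

lemma trace_mult_transpose: "trace (A ** transpose B) = A \<bullet> (B :: real^'n^'n)"
  by (simp add: trace_def matrix_matrix_mult_def transpose_def inner_vec_def)

lemma inner_transpose: "transpose A \<bullet> transpose B = A \<bullet> (B :: real^'n^'n)"
  unfolding trace_mult_transpose[symmetric]
  using trace_transpose[of "transpose B ** A"]
  by (simp add: matrix_transpose_mul trace_mul_sym[of "transpose A"] trace_mul_sym[of A])

lemma two_inner_le: "2 * (x \<bullet> y) \<le> x \<bullet> x + y \<bullet> (y :: 'b::real_inner)"
  using inner_ge_zero[of "x - y"] by (simp add: inner_diff inner_commute)

lemma trace_dyadic_power_cyclic:
  "trace (dyadic_power k (A ** B)) = trace (dyadic_power k (B ** A))"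
proof (induction k arbitrary: A B)
  case 0
  show ?case using trace_mul_sym[of A B] by simp
next
  case (Suc k)
  have "trace (dyadic_power (Suc k) (A ** B)) = trace (dyadic_power k (A ** (B ** A ** B)))"
    by (simp add: matrix_mul_assoc)
  also have "\<dots> = trace (dyadic_power k ((B ** A ** B) ** A))"
    by (rule Suc)
  finally show ?case by (simp add: matrix_mul_assoc)
qed

text \<open>
  A power-of-two version of the Golden-Thompson inequality.  The two estimates are proved together:
  the first one at level \<open>k + 1\<close> applies the second one to \<open>X X\<^sup>T\<close> and \<open>X\<^sup>T X\<close>, and the second one at
  level \<open>k + 1\<close> applies the first one to \<open>A B\<close>; between the two, traces are rotated cyclically.
\<close>

lemma trace_dyadic_power_bounds:
  fixes X A B :: "real^'n^'n"
  shows "trace (dyadic_power (Suc k) X) \<le> trace (dyadic_power k (X ** transpose X))"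
    and "transpose A = A \<Longrightarrow> transpose B = B \<Longrightarrow>
      trace (dyadic_power k (A ** B)) \<le> trace (dyadic_power k A ** dyadic_power k B)"
proof (induction k arbitrary: X A B)
  case 0
  {
    case 1
    have "2 * (X \<bullet> transpose X) \<le> X \<bullet> X + transpose X \<bullet> transpose X"
      by (rule two_inner_le)
    moreover have "X \<bullet> transpose X = trace (X ** X)"
      using trace_mult_transpose[of X "transpose X"] by simp
    ultimately show ?case
      by (simp add: inner_transpose trace_mult_transpose)
  next
    case 2
    show ?case by simp
  }
next
  case (Suc k)
  {
    case 1
    define P Q where "P = X ** transpose X" and "Q = transpose X ** X"
    have sym: "transpose P = P" "transpose Q = Q"
      by (simp_all add: P_def Q_def matrix_transpose_mul)
    \<comment> \<open>up to rotation, \<open>X\<^sup>2 (X\<^sup>2)\<^sup>T\<close> is \<open>P Q\<close>, and the powers of \<open>P\<close> and \<open>Q\<close> have equal traces\<close>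
    have "trace (dyadic_power (Suc (Suc k)) X) \<le>
        trace (dyadic_power k ((X ** X) ** transpose (X ** X)))"
      using Suc(1)[of "X ** X"] by simp
    also have "\<dots> = trace (dyadic_power k (X ** (P ** transpose X)))"
      by (simp add: P_def matrix_transpose_mul matrix_mul_assoc)
    also have "\<dots> = trace (dyadic_power k (P ** Q))"
      unfolding trace_dyadic_power_cyclic[of k X] by (simp add: Q_def matrix_mul_assoc)
    also have "\<dots> \<le> trace (dyadic_power k P ** dyadic_power k Q)"
      by (rule Suc(2)[OF sym])
    also have "\<dots> = dyadic_power k P \<bullet> dyadic_power k Q"
      by (simp add: sym transpose_dyadic_power flip: trace_mult_transpose)
    also have "2 * \<dots> \<le> dyadic_power k P \<bullet> dyadic_power k P + dyadic_power k Q \<bullet> dyadic_power k Q"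
      by (rule two_inner_le)
    also have "\<dots> = trace (dyadic_power (Suc k) P) + trace (dyadic_power (Suc k) Q)"
      unfolding dyadic_power_Suc
      by (simp add: sym transpose_dyadic_power flip: trace_mult_transpose)
    also have "trace (dyadic_power (Suc k) Q) = trace (dyadic_power (Suc k) P)"
      unfolding P_def Q_def by (rule trace_dyadic_power_cyclic)
    finally show ?case by (simp add: P_def)
  next
    case (2 A B)
    have "trace (dyadic_power (Suc k) (A ** B)) \<le>
        trace (dyadic_power k ((A ** B) ** transpose (A ** B)))"
      by (rule Suc(1))
    also have "\<dots> = trace (dyadic_power k (A ** (B ** B ** A)))"
      using 2 by (simp add: matrix_transpose_mul matrix_mul_assoc)
    also have "\<dots> = trace (dyadic_power k ((B ** B) ** (A ** A)))"
      unfolding trace_dyadic_power_cyclic[of k A] by (simp add: matrix_mul_assoc)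
    also have "\<dots> = trace (dyadic_power k ((A ** A) ** (B ** B)))"
      by (rule trace_dyadic_power_cyclic)
    also have "\<dots> \<le> trace (dyadic_power k (A ** A) ** dyadic_power k (B ** B))"
      by (rule Suc(2)) (simp_all add: 2 matrix_transpose_mul)
    finally show ?case by simp
  }
qed

section \<open>Rank-one updates of the identity\<close>

definition rank_one_update :: "real \<Rightarrow> real^'n \<Rightarrow> real^'n^'n" where
  "rank_one_update b v = mat 1 + (\<chi> i j. b * (v$i * v$j))"

lemma transpose_rank_one_update [simp]: "transpose (rank_one_update b v) = rank_one_update b v"
  by (auto simp: rank_one_update_def transpose_def vec_eq_iff mat_def)

lemma rank_one_update_vector: "rank_one_update b v *v x = x + (b * (v \<bullet> x)) *\<^sub>R v"
proof -
  have "(\<chi> i j. b * (v$i * v$j)) *v x = (b * (v \<bullet> x)) *\<^sub>R v"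
    by (simp add: vec_eq_iff matrix_vector_mult_def inner_vec_def sum_distrib_left sum_distrib_right mult_ac)
  then show ?thesis
    by (simp add: rank_one_update_def matrix_vector_mult_add_rdistrib)
qed

lemma rank_one_update_square:
  "rank_one_update b v ** rank_one_update b v = rank_one_update (2 * b + b\<^sup>2 * (v \<bullet> v)) v"
proof -
  have "(rank_one_update b v ** rank_one_update b v) *v x =
      rank_one_update (2 * b + b\<^sup>2 * (v \<bullet> v)) v *v x" for x
  proof -
    have "rank_one_update b v *v (rank_one_update b v *v x) =
        x + (b * (v \<bullet> x) + b * (v \<bullet> x + b * (v \<bullet> x) * (v \<bullet> v))) *\<^sub>R v"
      by (simp add: rank_one_update_vector inner_add_right scaleR_add_left)
    then show ?thesis
      by (simp add: matrix_vector_mul_assoc[symmetric] rank_one_update_vector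
          power2_eq_square algebra_simps)
  qed
  then show ?thesis
    by (simp add: matrix_eq)
qed

text \<open>
  Powers of \<open>I + b v v\<^sup>T\<close> stay of this form, and the eigenvalue belonging to \<open>v\<close> is raised to the
  same power.
\<close>

lemma dyadic_power_rank_one_update:
  "\<exists>c. dyadic_power k (rank_one_update b v) = rank_one_update c v \<and>
       1 + c * (v \<bullet> v) = (1 + b * (v \<bullet> v)) ^ 2 ^ k"
proof (induction k arbitrary: b)
  case 0
  then show ?case by auto
next
  case (Suc k)
  obtain c where c: "dyadic_power k (rank_one_update (2 * b + b\<^sup>2 * (v \<bullet> v)) v) = rank_one_update c v"
    "1 + c * (v \<bullet> v) = (1 + (2 * b + b\<^sup>2 * (v \<bullet> v)) * (v \<bullet> v)) ^ 2 ^ k"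
    using Suc by blast
  have "1 + (2 * b + b\<^sup>2 * (v \<bullet> v)) * (v \<bullet> v) = (1 + b * (v \<bullet> v))\<^sup>2"
    by (simp add: power2_eq_square algebra_simps)
  with c show ?case
    by (auto simp: rank_one_update_square power_mult[symmetric] mult.commute)
qed

lemma trace_mult_rank_one_update:
  "trace (A ** rank_one_update b v) = trace A + b * (v \<bullet> (A *v v))"
proof -
  have "trace (A ** (\<chi> i j. b * (v$i * v$j))) = b * (v \<bullet> (A *v v))"
    by (simp add: trace_def matrix_matrix_mult_def matrix_vector_mult_def inner_vec_def
        sum_distrib_left mult_ac)
  then show ?thesis
    by (simp add: rank_one_update_def matrix_add_ldistrib trace_add)
qed

section \<open>Quadratic forms, traces and the spectral norm\<close>

lemma inner_transpose_mult:
  fixes C :: "real^'n^'n"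
  shows "x \<bullet> ((transpose C ** C) *v y) = (C *v x) \<bullet> (C *v y)"
proof -
  have "(C *v x) \<bullet> (C *v y) = (C *v y) \<bullet> (C *v x)" by (rule inner_commute)
  also have "\<dots> = ((C *v y) v* C) \<bullet> x" by (rule dot_lmul_matrix[symmetric])
  also have "\<dots> = x \<bullet> (transpose C *v (C *v y))"
    by (simp add: inner_commute)
  finally show ?thesis by (simp add: matrix_vector_mul_assoc del: transpose_matrix_vector)
qed

lemma inner_square_matrix:
  fixes A :: "real^'n^'n"
  assumes "transpose A = A"
  shows "v \<bullet> ((A ** A) *v v) = (A *v v) \<bullet> (A *v v)"
  using dot_lmul_matrix[of v A "A *v v"] transpose_matrix_vector[of A v] assms
  by (simp add: matrix_vector_mul_assoc)

lemma trace_square_nonneg: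
  fixes A :: "real^'n^'n"
  assumes "transpose A = A"
  shows "0 \<le> trace (A ** A)"
  using trace_mult_transpose[of A A] assms by simp

lemma norm_matrix_vector_le: "norm (A *v x) \<le> norm A * norm (x :: real^'n)" for A :: "real^'n^'n"
proof -
  have "(A *v x) \<bullet> (A *v x) \<le> (A \<bullet> A) * (x \<bullet> x)"
  proof -
    have "(A *v x) \<bullet> (A *v x) = (\<Sum>i\<in>UNIV. (A$i \<bullet> x)\<^sup>2)"
      by (simp add: inner_vec_def matrix_vector_mult_def power2_eq_square)
    also have "\<dots> \<le> (\<Sum>i\<in>UNIV. (A$i \<bullet> A$i) * (x \<bullet> x))"
      by (intro sum_mono Cauchy_Schwarz_ineq)
    also have "\<dots> = (A \<bullet> A) * (x \<bullet> x)"
      by (simp add: inner_vec_def[of A A] sum_distrib_right)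
    finally show ?thesis .
  qed
  then show ?thesis
    by (simp add: norm_eq_sqrt_inner flip: real_sqrt_mult)
qed

text \<open>
  This replaces the passage from the largest eigenvalue to the trace:
  \<open>(w\<^sup>T A w)\<^sup>2 \<le> \<bar>A w\<bar>\<^sup>2 = w\<^sup>T A\<^sup>2 w\<close> for a unit vector \<open>w\<close>, and the last squaring is absorbed by the
  Frobenius norm.
\<close>

lemma quadratic_form_power_le_trace:
  assumes "transpose A = A" "norm w = 1" "0 \<le> w \<bullet> (A *v w)"
  shows "(w \<bullet> (A *v w)) ^ 2 ^ Suc k \<le> trace (dyadic_power (Suc k) A)"
  using assms
proof (induction k arbitrary: A)
  case 0
  have "(w \<bullet> (A *v w))\<^sup>2 \<le> (norm (A *v w))\<^sup>2"
    using 0 norm_cauchy_schwarz[of w "A *v w"] by (intro power_mono) auto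
  also have "\<dots> \<le> (norm A)\<^sup>2"
    using norm_matrix_vector_le[of A w] 0 by (intro power_mono) auto
  also have "\<dots> = trace (A ** A)"
    using 0 trace_mult_transpose[of A A] by (simp add: power2_norm_eq_inner)
  finally show ?case by simp
next
  case (Suc k)
  have "(w \<bullet> (A *v w))\<^sup>2 \<le> (norm (A *v w))\<^sup>2"
    using Suc norm_cauchy_schwarz[of w "A *v w"] by (intro power_mono) auto
  also have "\<dots> = w \<bullet> ((A ** A) *v w)"
    using Suc by (simp add: inner_square_matrix power2_norm_eq_inner)
  finally have *: "(w \<bullet> (A *v w))\<^sup>2 \<le> w \<bullet> ((A ** A) *v w)" .
  have "(w \<bullet> (A *v w)) ^ 2 ^ Suc (Suc k) = ((w \<bullet> (A *v w))\<^sup>2) ^ 2 ^ Suc k"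
    by (simp add: power_mult[symmetric] mult_ac)
  also have "\<dots> \<le> (w \<bullet> ((A ** A) *v w)) ^ 2 ^ Suc k"
    using * by (intro power_mono) auto
  also have "\<dots> \<le> trace (dyadic_power (Suc k) (A ** A))"
    using Suc.prems by (intro Suc.IH order_trans[OF _ *]) (auto simp: matrix_transpose_mul)
  finally show ?case by simp
qed

text \<open>
  For a symmetric matrix the numerical radius controls the norm, by polarisation of \<open>y\<^sup>T H x\<close> with
  \<open>y\<close> the multiple of \<open>H x\<close> that has the length of \<open>x\<close>.
\<close>

lemma spectral_norm_le_iff:
  assumes "transpose H = H"
  shows "spectral_norm H \<le> c \<longleftrightarrow> (\<forall>w. norm w = 1 \<longrightarrow> \<bar>w \<bullet> (H *v w)\<bar> \<le> c)"
proof safe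
  fix w :: "real^'a" assume "spectral_norm H \<le> c" and w: "norm w = 1"
  have "\<bar>w \<bullet> (H *v w)\<bar> \<le> norm w * norm (H *v w)"
    by (rule Cauchy_Schwarz_ineq2)
  also have "\<dots> \<le> spectral_norm H"
    using onorm[OF matrix_vector_mul_bounded_linear, of H w] w by (simp add: spectral_norm_def)
  also have "\<dots> \<le> c" by fact
  finally show "\<bar>w \<bullet> (H *v w)\<bar> \<le> c" .
next
  assume unit: "\<forall>w. norm w = 1 \<longrightarrow> \<bar>w \<bullet> (H *v w)\<bar> \<le> c"
  have q: "\<bar>v \<bullet> (H *v v)\<bar> \<le> c * (norm v)\<^sup>2" for v
  proof (cases "v = 0")
    case False
    have "\<bar>(v /\<^sub>R norm v) \<bullet> (H *v (v /\<^sub>R norm v))\<bar> \<le> c"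
      using unit[rule_format, of "v /\<^sub>R norm v"] False by simp
    then show ?thesis
      using False by (simp add: matrix_vector_mult_scaleR abs_mult power2_eq_square divide_simps mult_ac)
  qed auto
  show "spectral_norm H \<le> c"
    unfolding spectral_norm_def
  proof (rule onorm_le)
    fix x
    show "norm (H *v x) \<le> c * norm x"
    proof (cases "x = 0 \<or> H *v x = 0")
      case True
      have "0 \<le> c * (norm x)\<^sup>2" using q[of x] by linarith
      then have "x \<noteq> 0 \<Longrightarrow> 0 \<le> c" by (simp add: zero_le_mult_iff)
      with True show ?thesis by (cases "x = 0") auto
    next
      case False
      define y where "y = (norm x / norm (H *v x)) *\<^sub>R (H *v x)"
      have y: "norm y = norm x" using False by (simp add: y_def)
      have sym: "a \<bullet> (H *v b) = b \<bullet> (H *v a)" for a b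
        using dot_lmul_matrix[of a H b] transpose_matrix_vector[of H a] assms by (simp add: inner_commute)
      have "4 * (y \<bullet> (H *v x)) = (x + y) \<bullet> (H *v (x + y)) - (x - y) \<bullet> (H *v (x - y))"
        using sym[of x y] by (simp add: algebra_simps inner_diff_left inner_diff_right inner_add_left inner_add_right)
      also have "\<dots> \<le> c * (norm (x + y))\<^sup>2 + c * (norm (x - y))\<^sup>2"
        using q[of "x + y"] q[of "x - y"] by linarith
      also have "\<dots> = 4 * c * (norm x)\<^sup>2"
        using y by (simp add: power2_norm_eq_inner inner_diff_left inner_diff_right inner_add_left inner_add_right
            algebra_simps inner_commute norm_eq)
      finally have "y \<bullet> (H *v x) \<le> c * (norm x)\<^sup>2" by simp
      moreover have "y \<bullet> (H *v x) = norm x * norm (H *v x)"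
        using False by (simp add: y_def dot_square_norm power2_eq_square)
      ultimately have "norm x * norm (H *v x) \<le> norm x * (c * norm x)"
        by (simp add: power2_eq_square mult_ac)
      then show ?thesis using False by (simp add: mult_le_cancel_left_pos)
    qed
  qed
qed


section \<open>Symmetric products of rank-one updates\<close>

text \<open>
  With \<open>a = t / (2 m N)\<close>, the \<open>N\<close>-th power of this product stands in for the exponential of
  \<open>(t/m) \<Sum> v\<^sub>i v\<^sub>i\<^sup>T\<close>.  Each factor occurs on both sides, which keeps the product symmetric and
  doubles its first-order contribution.
\<close>

fun sym_prod :: "real \<Rightarrow> (nat \<Rightarrow> real^'n) \<Rightarrow> nat \<Rightarrow> real^'n^'n" where
  "sym_prod a v 0 = mat 1"
| "sym_prod a v (Suc j) =
     rank_one_update a (v (Suc j)) ** sym_prod a v j ** rank_one_update a (v (Suc j))"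

lemma transpose_sym_prod [simp]: "transpose (sym_prod a v j) = sym_prod a v j"
  by (induction j) (simp_all add: matrix_transpose_mul matrix_mul_assoc)

lemma sym_prod_cong:
  "(\<And>i. i \<in> {1..j} \<Longrightarrow> v i = v' i) \<Longrightarrow> sym_prod a v j = sym_prod a v' j"
  by (induction j) auto

lemma minus_le_of_abs_le: "\<bar>x\<bar> \<le> c \<Longrightarrow> - c \<le> (x :: real)"
  by linarith

text \<open>
  To first order in \<open>a\<close> the product is \<open>I + 2 a \<Sum> v\<^sub>i v\<^sub>i\<^sup>T\<close>.  What matters is that the remainder
  constant \<open>C\<close> depends on \<open>K\<close> and \<open>j\<close> only, so that one choice of \<open>a\<close> serves all samples at once.
\<close>

lemma sym_prod_quadratic_form_bound:
  assumes K: "0 \<le> K"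
  shows "\<exists>C\<ge>0. \<forall>a v (w :: real^'n). \<bar>a\<bar> \<le> 1 \<longrightarrow> (\<forall>i\<in>{1..j}. v i \<bullet> v i \<le> K) \<longrightarrow>
    w \<bullet> w + 2 * a * (\<Sum>i\<in>{1..j}. (w \<bullet> v i)\<^sup>2) - a\<^sup>2 * C * (w \<bullet> w) \<le> w \<bullet> (sym_prod a v j *v w)"
proof (induction j)
  case 0
  show ?case by (intro exI[of _ 0]) auto
next
  case (Suc j)
  then obtain C where C: "0 \<le> C" and IH: "\<And>a v (w :: real^'n). \<bar>a\<bar> \<le> 1 \<Longrightarrow>
      (\<forall>i\<in>{1..j}. v i \<bullet> v i \<le> K) \<Longrightarrow>
      w \<bullet> w + 2 * a * (\<Sum>i\<in>{1..j}. (w \<bullet> v i)\<^sup>2) - a\<^sup>2 * C * (w \<bullet> w) \<le> w \<bullet> (sym_prod a v j *v w)"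
    by blast
  define C' where "C' = real j * (4 * K\<^sup>2 + 2 * K ^ 3) + (1 + K)\<^sup>2 * C"
  have C': "0 \<le> C'" using K C by (simp add: C'_def)
  have "w \<bullet> w + 2 * a * (\<Sum>i\<in>{1..Suc j}. (w \<bullet> v i)\<^sup>2) - a\<^sup>2 * C' * (w \<bullet> w)
      \<le> w \<bullet> (sym_prod a v (Suc j) *v w)"
    if a: "\<bar>a\<bar> \<le> 1" and v: "\<forall>i\<in>{1..Suc j}. v i \<bullet> v i \<le> K" for a v and w :: "real^'n"
  proof -
    define p q where "p = v (Suc j)" and "q = p \<bullet> w"
    define W where "W = w + (a * q) *\<^sub>R p"
    have pK: "p \<bullet> p \<le> K" using v by (auto simp: p_def)
    have q2: "q\<^sup>2 \<le> K * (w \<bullet> w)"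
      using Cauchy_Schwarz_ineq[of p w] mult_right_mono[OF pK, of "w \<bullet> w"] by (simp add: q_def)
    have a2: "a\<^sup>2 \<le> 1" using a by (simp add: abs_square_le_1)
    have WW: "W \<bullet> W = w \<bullet> w + 2 * a * q\<^sup>2 + a\<^sup>2 * q\<^sup>2 * (p \<bullet> p)"
      by (simp add: W_def q_def inner_add_left inner_add_right inner_commute power2_eq_square algebra_simps)
    have W_lower: "w \<bullet> w + 2 * a * q\<^sup>2 \<le> W \<bullet> W"
      by (simp add: WW)
    have W_upper: "W \<bullet> W \<le> (1 + K)\<^sup>2 * (w \<bullet> w)"
    proof -
      have "a * q\<^sup>2 \<le> 1 * q\<^sup>2" using a by (intro mult_right_mono) auto
      moreover have "a\<^sup>2 * q\<^sup>2 * (p \<bullet> p) \<le> 1 * (K * (w \<bullet> w)) * K"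
        using a2 q2 pK K by (intro mult_mono) auto
      moreover have "(1 + K)\<^sup>2 * (w \<bullet> w) = w \<bullet> w + 2 * (K * (w \<bullet> w)) + K * (w \<bullet> w) * K"
        by (simp add: power2_eq_square algebra_simps)
      ultimately show ?thesis using q2 WW by linarith
    qed
    have scale: "- (a\<^sup>2 * (c * X)) \<le> a\<^sup>2 * (c * Z)" if "- X \<le> Z" "0 \<le> c" for c X Z :: real
    proof -
      have "a\<^sup>2 * (c * (- X)) \<le> a\<^sup>2 * (c * Z)"
        using that by (intro mult_left_mono) auto
      then show ?thesis by simp
    qed
    have summand: "2 * a * (w \<bullet> v i)\<^sup>2 - a\<^sup>2 * (4 * K\<^sup>2 + 2 * K ^ 3) * (w \<bullet> w) \<le> 2 * a * (W \<bullet> v i)\<^sup>2"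
      if i: "i \<in> {1..j}" for i
    proof -
      define s r where "s = w \<bullet> v i" and "r = p \<bullet> v i"
      have vi: "v i \<bullet> v i \<le> K" using v i by auto
      have s2: "s\<^sup>2 \<le> K * (w \<bullet> w)"
        using Cauchy_Schwarz_ineq[of w "v i"] mult_left_mono[OF vi, of "w \<bullet> w"]
        by (simp add: s_def mult.commute)
      have r2: "r\<^sup>2 \<le> K\<^sup>2"
        using Cauchy_Schwarz_ineq[of p "v i"] mult_mono[OF pK vi K] by (simp add: r_def power2_eq_square)
      have rK: "\<bar>r\<bar> \<le> K" using r2 K by (simp add: abs_le_square_iff[symmetric])
      have "2 * (\<bar>s\<bar> * \<bar>q\<bar>) \<le> s\<^sup>2 + q\<^sup>2"
        using sum_squares_bound[of "\<bar>s\<bar>" "\<bar>q\<bar>"] by simp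
      then have sq: "\<bar>s\<bar> * \<bar>q\<bar> \<le> K * (w \<bullet> w)" using s2 q2 by linarith
      have "\<bar>s * q * r\<bar> \<le> K * (w \<bullet> w) * K"
        using mult_mono[OF sq rK] K by (simp add: abs_mult)
      then have *: "- (K * (w \<bullet> w) * K) \<le> s * q * r" by (rule minus_le_of_abs_le)
      have 1: "- (a\<^sup>2 * (4 * (K * (w \<bullet> w) * K))) \<le> a\<^sup>2 * (4 * (s * q * r))"
        by (rule scale) (use * in auto)
      have b: "q\<^sup>2 * r\<^sup>2 \<le> K * (w \<bullet> w) * K\<^sup>2"
        using q2 r2 K by (intro mult_mono) auto
      have "\<bar>a * (q\<^sup>2 * r\<^sup>2)\<bar> \<le> 1 * (K * (w \<bullet> w) * K\<^sup>2)"
        using mult_mono[OF a b] by (simp add: abs_mult)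
      then have **: "- (K * (w \<bullet> w) * K\<^sup>2) \<le> a * (q\<^sup>2 * r\<^sup>2)"
        by (intro minus_le_of_abs_le) simp
      have 2: "- (a\<^sup>2 * (2 * (K * (w \<bullet> w) * K\<^sup>2))) \<le> a\<^sup>2 * (2 * (a * (q\<^sup>2 * r\<^sup>2)))"
        by (rule scale) (use ** in auto)
      have "W \<bullet> v i = s + a * q * r"
        by (simp add: W_def s_def r_def inner_add_left)
      then have "2 * a * (W \<bullet> v i)\<^sup>2 = 2 * a * s\<^sup>2 + a\<^sup>2 * (4 * (s * q * r)) + a\<^sup>2 * (2 * (a * (q\<^sup>2 * r\<^sup>2)))"
        by (simp add: power2_eq_square algebra_simps)
      moreover have "a\<^sup>2 * (4 * K\<^sup>2 + 2 * K ^ 3) * (w \<bullet> w) =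
          a\<^sup>2 * (4 * (K * (w \<bullet> w) * K)) + a\<^sup>2 * (2 * (K * (w \<bullet> w) * K\<^sup>2))"
        by (simp add: power2_eq_square power3_eq_cube algebra_simps)
      ultimately show ?thesis using 1 2 unfolding s_def[symmetric] by linarith
    qed
    have "2 * a * (\<Sum>i\<in>{1..j}. (w \<bullet> v i)\<^sup>2) - real j * (a\<^sup>2 * (4 * K\<^sup>2 + 2 * K ^ 3) * (w \<bullet> w))
        = (\<Sum>i\<in>{1..j}. 2 * a * (w \<bullet> v i)\<^sup>2 - a\<^sup>2 * (4 * K\<^sup>2 + 2 * K ^ 3) * (w \<bullet> w))"
      by (simp add: sum_subtractf sum_distrib_left)
    also have "\<dots> \<le> (\<Sum>i\<in>{1..j}. 2 * a * (W \<bullet> v i)\<^sup>2)"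
      by (rule sum_mono) (rule summand)
    also have "\<dots> = 2 * a * (\<Sum>i\<in>{1..j}. (W \<bullet> v i)\<^sup>2)"
      by (simp add: sum_distrib_left)
    finally have sums: "2 * a * (\<Sum>i\<in>{1..j}. (w \<bullet> v i)\<^sup>2)
        - real j * (a\<^sup>2 * (4 * K\<^sup>2 + 2 * K ^ 3) * (w \<bullet> w)) \<le> 2 * a * (\<Sum>i\<in>{1..j}. (W \<bullet> v i)\<^sup>2)" .
    have rem: "a\<^sup>2 * C * (W \<bullet> W) \<le> a\<^sup>2 * C * ((1 + K)\<^sup>2 * (w \<bullet> w))"
      using W_upper C by (intro mult_left_mono) auto
    have "w \<bullet> (sym_prod a v (Suc j) *v w) = W \<bullet> (sym_prod a v j *v W)"
    proof -
      have "rank_one_update a p *v w = W"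
        by (simp add: rank_one_update_vector W_def q_def)
      moreover have "w \<bullet> (rank_one_update a p *v y) = (rank_one_update a p *v w) \<bullet> y" for y
        by (simp add: rank_one_update_vector inner_add_left inner_add_right inner_commute algebra_simps)
      ultimately show ?thesis
        by (simp add: p_def[symmetric] matrix_vector_mul_assoc[symmetric])
    qed
    moreover have "W \<bullet> W + 2 * a * (\<Sum>i\<in>{1..j}. (W \<bullet> v i)\<^sup>2) - a\<^sup>2 * C * (W \<bullet> W)
        \<le> W \<bullet> (sym_prod a v j *v W)"
      using a v by (intro IH) auto
    moreover have "a\<^sup>2 * C' * (w \<bullet> w) =
        real j * (a\<^sup>2 * (4 * K\<^sup>2 + 2 * K ^ 3) * (w \<bullet> w)) + a\<^sup>2 * C * ((1 + K)\<^sup>2 * (w \<bullet> w))"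
      by (simp add: C'_def algebra_simps)
    moreover have "2 * a * (\<Sum>i\<in>{1..Suc j}. (w \<bullet> v i)\<^sup>2) = 2 * a * (\<Sum>i\<in>{1..j}. (w \<bullet> v i)\<^sup>2) + 2 * a * q\<^sup>2"
      by (simp add: q_def p_def inner_commute algebra_simps)
    ultimately show ?thesis
      using W_lower sums rem by linarith
  qed
  with C' show ?case by blast
qed

text \<open>
  The effect of one more sample.  By the trace inequality the two outer factors \<open>Y\<close> contribute at most
  \<open>Y\<close> to the power \<open>2 N\<close>, again a rank-one update, whose eigenvalue is at most \<open>exp (t r / m)\<close> with
  \<open>r = \<bar>v\<bar>\<^sup>2\<close>.  Convexity of the exponential on \<open>[0, K]\<close> replaces this by the chord, which is linear
  in \<open>r\<close>; hence the slope \<open>\<beta>\<close>.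
\<close>

lemma trace_dyadic_power_update_bound:
  fixes A :: "real^'n^'n"
  assumes A: "transpose A = A" and k: "0 < k"
    and v: "v \<bullet> v \<le> K" and K: "0 < K" and m: "0 < m"
    and a: "a = t / (2 * m * 2 ^ k)" and small: "\<bar>a\<bar> * K \<le> 1"
  defines "\<beta> \<equiv> (exp (t * K / m) - 1) / K"
  shows "trace (dyadic_power k (rank_one_update a v ** A ** rank_one_update a v))
    \<le> trace (dyadic_power k A) + \<beta> * (v \<bullet> (dyadic_power k A *v v))"
proof -
  let ?Y = "rank_one_update a v" and ?C = "dyadic_power k A"
  define r where "r = v \<bullet> v"
  obtain c where c: "dyadic_power (Suc k) ?Y = rank_one_update c v"
    "1 + c * r = (1 + a * r) ^ 2 ^ Suc k"
    using dyadic_power_rank_one_update[of "Suc k" a v] unfolding r_def by blast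
  obtain k' where k': "k = Suc k'" using k by (cases k) auto
  have C_nonneg: "0 \<le> v \<bullet> (?C *v v)"
    unfolding k' dyadic_power_Suc by (subst inner_square_matrix) (simp_all add: transpose_dyadic_power A)
  have cb: "c \<le> \<beta>" if "r > 0"
  proof -
    have "\<bar>a\<bar> * r \<le> \<bar>a\<bar> * K" using v by (intro mult_left_mono) (auto simp: r_def)
    then have "\<bar>a * r\<bar> \<le> 1" using small \<open>r > 0\<close> by (simp add: abs_mult)
    then have "1 + c * r \<le> exp (a * r) ^ 2 ^ Suc k"
      unfolding c(2) by (intro power_mono exp_ge_add_one_self) auto
    also have "\<dots> = exp (t * r / m)"
      using m by (simp add: exp_of_nat_mult[symmetric] a)
    also have "\<dots> = exp ((1 - r / K) *\<^sub>R 0 + (r / K) *\<^sub>R (t * K / m))"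
      using K by simp
    also have "\<dots> \<le> (1 - r / K) * exp 0 + (r / K) * exp (t * K / m)"
      using v K \<open>r > 0\<close> by (intro convex_onD[OF exp_convex]) (auto simp: r_def)
    also have "\<dots> = 1 + \<beta> * r"
      using K by (simp add: \<beta>_def field_simps)
    finally show ?thesis using \<open>r > 0\<close> by simp
  qed
  have bound: "c * (v \<bullet> (?C *v v)) \<le> \<beta> * (v \<bullet> (?C *v v))"
  proof (cases "r > 0")
    case True
    then show ?thesis using cb C_nonneg by (intro mult_right_mono)
  next
    case False
    then have "v = 0" by (simp add: r_def)
    then show ?thesis by simp
  qed
  have "trace (dyadic_power k (?Y ** A ** ?Y)) = trace (dyadic_power k (A ** (?Y ** ?Y)))"
    using trace_dyadic_power_cyclic[of k ?Y "A ** ?Y"] by (simp add: matrix_mul_assoc)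
  also have "\<dots> \<le> trace (?C ** dyadic_power k (?Y ** ?Y))"
    by (rule trace_dyadic_power_bounds(2)) (simp_all add: A matrix_transpose_mul)
  also have "dyadic_power k (?Y ** ?Y) = rank_one_update c v"
    using c(1) by simp
  also have "trace (?C ** rank_one_update c v) \<le> trace ?C + \<beta> * (v \<bullet> (?C *v v))"
    unfolding trace_mult_rank_one_update using bound by simp
  finally show ?thesis .
qed


section \<open>A matrix Chernoff bound\<close>

lemma borel_measurable_matrixI:
  fixes A :: "'b \<Rightarrow> real^'n^'m"
  assumes "\<And>i j. (\<lambda>x. A x $ i $ j) \<in> borel_measurable N"
  shows "A \<in> borel_measurable N"
proof (subst borel_measurable_euclidean_space, intro ballI)
  fix b :: "real^'n^'m" assume "b \<in> Basis"
  then obtain i j where "b = axis i (axis j 1)"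
    by (auto simp: Basis_vec_def)
  then show "(\<lambda>x. A x \<bullet> b) \<in> borel_measurable N"
    using assms by (simp add: inner_axis)
qed

lemma borel_measurable_vecI:
  fixes v :: "'b \<Rightarrow> real^'n"
  assumes "\<And>i. (\<lambda>x. v x $ i) \<in> borel_measurable N"
  shows "v \<in> borel_measurable N"
proof (subst borel_measurable_euclidean_space, intro ballI)
  fix b :: "real^'n" assume "b \<in> Basis"
  then obtain i where "b = axis i 1"
    by (auto simp: Basis_vec_def)
  then show "(\<lambda>x. v x \<bullet> b) \<in> borel_measurable N"
    using assms by (simp add: inner_axis)
qed

lemma borel_measurable_vec_nth [measurable (raw)]:
  fixes v :: "'b \<Rightarrow> 'c::euclidean_space^'n"
  assumes "v \<in> borel_measurable N"
  shows "(\<lambda>x. v x $ i) \<in> borel_measurable N"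
  using assms by (rule borel_measurable_continuous_on[rotated]) (intro continuous_intros)

lemma borel_measurable_matrix_mult [measurable (raw)]:
  fixes A B :: "'b \<Rightarrow> real^'n^'n"
  assumes [measurable]: "A \<in> borel_measurable N" "B \<in> borel_measurable N"
  shows "(\<lambda>x. A x ** B x) \<in> borel_measurable N"
  by (rule borel_measurable_matrixI) (simp add: matrix_matrix_mult_def)

lemma borel_measurable_dyadic_power [measurable (raw)]:
  fixes A :: "'b \<Rightarrow> real^'n^'n"
  assumes "A \<in> borel_measurable N"
  shows "(\<lambda>x. dyadic_power k (A x)) \<in> borel_measurable N"
  using assms by (induction k arbitrary: A) (auto intro: borel_measurable_matrix_mult)

lemma borel_measurable_trace [measurable (raw)]:
  fixes A :: "'b \<Rightarrow> real^'n^'n"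
  assumes [measurable]: "A \<in> borel_measurable N"
  shows "(\<lambda>x. trace (A x)) \<in> borel_measurable N"
  unfolding trace_def by measurable

lemma borel_measurable_rank_one_update [measurable (raw)]:
  fixes v :: "'b \<Rightarrow> real^'n"
  assumes [measurable]: "v \<in> borel_measurable N"
  shows "(\<lambda>x. rank_one_update a (v x)) \<in> borel_measurable N"
  by (rule borel_measurable_matrixI) (simp add: rank_one_update_def)

lemma borel_measurable_sym_prod [measurable (raw)]:
  fixes v :: "'b \<Rightarrow> nat \<Rightarrow> real^'n"
  assumes "\<And>i. i \<in> {1..j} \<Longrightarrow> (\<lambda>x. v x i) \<in> borel_measurable N"
  shows "(\<lambda>x. sym_prod a (v x) j) \<in> borel_measurable N"
  using assms
proof (induction j)
  case (Suc j)
  have [measurable]: "(\<lambda>x. sym_prod a (v x) j) \<in> borel_measurable N"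
    "(\<lambda>x. v x (Suc j)) \<in> borel_measurable N"
    using Suc by auto
  show ?case by simp
qed simp

lemma expectation_quadratic_form:
  fixes \<phi> :: "'a \<Rightarrow> real^'n"
  assumes int: "\<And>i j. integrable \<nu> (\<lambda>x. \<phi> x $ i * \<phi> x $ j)"
    and iso: "\<And>i j. (\<integral>x. \<phi> x $ i * \<phi> x $ j \<partial>\<nu>) = (if i = j then 1 else 0)"
  shows "integrable \<nu> (\<lambda>x. \<phi> x \<bullet> (C *v \<phi> x))" "(\<integral>x. \<phi> x \<bullet> (C *v \<phi> x) \<partial>\<nu>) = trace C"
proof -
  have eq: "\<phi> x \<bullet> (C *v \<phi> x) = (\<Sum>i\<in>UNIV. \<Sum>j\<in>UNIV. C $ i $ j * (\<phi> x $ i * \<phi> x $ j))" for x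
    by (simp add: inner_vec_def matrix_vector_mult_def sum_distrib_left mult_ac)
  show "integrable \<nu> (\<lambda>x. \<phi> x \<bullet> (C *v \<phi> x))"
    unfolding eq by (intro Bochner_Integration.integrable_sum integrable_mult_right int)
  show "(\<integral>x. \<phi> x \<bullet> (C *v \<phi> x) \<partial>\<nu>) = trace C"
    unfolding eq by (simp add: int iso trace_def if_distrib[of "\<lambda>x. _ * x"] cong: if_cong)
qed

text \<open>
  Integrating out the last sample first: as \<open>\<E> \<phi> \<phi>\<^sup>T = I\<close>, the increment \<open>\<beta> \<phi>\<^sup>T C \<phi>\<close> has
  expectation \<open>\<beta> tr C\<close>, so every sample contributes at most a factor \<open>1 + \<beta>\<close>.
\<close>

lemma expected_trace_bound:
  fixes \<phi> :: "'a \<Rightarrow> real^'n" and t m a :: real and k :: nat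
  assumes "prob_space \<nu>"
    and meas [measurable]: "\<phi> \<in> borel_measurable \<nu>"
    and K: "0 < K" and bound: "\<And>x. x \<in> space \<nu> \<Longrightarrow> \<phi> x \<bullet> \<phi> x \<le> K"
    and iso: "\<And>i j. (\<integral>x. \<phi> x $ i * \<phi> x $ j \<partial>\<nu>) = (if i = j then 1 else 0)"
    and m: "0 < m" and k: "0 < k"
    and a: "a = t / (2 * m * 2 ^ k)" and small: "\<bar>a\<bar> * K \<le> 1"
  defines "\<beta> \<equiv> (exp (t * K / m) - 1) / K"
  assumes \<beta>: "0 \<le> 1 + \<beta>"
  shows "(\<integral>\<^sup>+x. ennreal (trace (dyadic_power k (sym_prod a (\<lambda>i. \<phi> (x i)) j))) \<partial>PiM {1..j} (\<lambda>_. \<nu>))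
    \<le> ennreal (real CARD('n) * (1 + \<beta>) ^ j)"
proof -
  interpret prob_space \<nu> by fact
  interpret P: product_sigma_finite "\<lambda>_::nat. \<nu>"
    by unfold_locales
  have comp: "\<bar>\<phi> x $ i * \<phi> x $ j\<bar> \<le> K" if "x \<in> space \<nu>" for x i j
  proof -
    have "\<bar>\<phi> x $ i\<bar> * \<bar>\<phi> x $ j\<bar> \<le> norm (\<phi> x) * norm (\<phi> x)"
      by (intro mult_mono component_le_norm_cart) auto
    then show ?thesis using bound[OF that] by (simp add: abs_mult dot_square_norm power2_eq_square)
  qed
  have int: "integrable \<nu> (\<lambda>x. \<phi> x $ i * \<phi> x $ j)" for i j
    by (rule integrable_const_bound[of _ K]) (auto intro!: AE_I2 comp)
  have nonneg: "0 \<le> trace (dyadic_power k A)" if "transpose A = A" for A :: "real^'n^'n"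
  proof -
    obtain k' where "k = Suc k'" using k by (cases k) auto
    then show ?thesis
      using trace_square_nonneg[of "dyadic_power k' A"] that
      by (simp only: dyadic_power_Suc transpose_dyadic_power)
  qed
  show ?thesis
  proof (induction j)
    case 0
    have "dyadic_power k (mat 1 :: real^'n^'n) = mat 1" for k
      by (induction k) auto
    then show ?case by (simp add: PiM_empty nn_integral_count_space_finite trace_I)
  next
    case (Suc j)
    have ins: "{1..Suc j} = insert (Suc j) {1..j}" by auto
    define f where "f = (\<lambda>j x. trace (dyadic_power k (sym_prod a (\<lambda>i. \<phi> (x i)) j)))"
    have f_meas: "f j \<in> borel_measurable (PiM {1..j} (\<lambda>_. \<nu>))" for j
      unfolding f_def by measurable
    have step: "(\<integral>\<^sup>+y. ennreal (f (Suc j) (x(Suc j := y))) \<partial>\<nu>) \<le> ennreal (1 + \<beta>) * ennreal (f j x)" for x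
    proof -
      let ?A = "sym_prod a (\<lambda>i. \<phi> (x i)) j"
      let ?C = "dyadic_power k ?A"
      have upd: "sym_prod a (\<lambda>i. \<phi> ((x(Suc j := y)) i)) j = ?A" for y
        by (rule sym_prod_cong) auto
      have le: "f (Suc j) (x(Suc j := y)) \<le> trace ?C + \<beta> * (\<phi> y \<bullet> (?C *v \<phi> y))" if "y \<in> space \<nu>" for y
        using trace_dyadic_power_update_bound[OF _ k bound[OF that] K m a small, of ?A]
        unfolding f_def by (simp add: upd \<beta>_def del: fun_upd_apply) (simp add: \<beta>_def)
      have ge: "0 \<le> f (Suc j) x" for x
        unfolding f_def by (rule nonneg) (rule transpose_sym_prod)
      have "(\<integral>\<^sup>+y. ennreal (f (Suc j) (x(Suc j := y))) \<partial>\<nu>)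
          \<le> (\<integral>\<^sup>+y. ennreal (trace ?C + \<beta> * (\<phi> y \<bullet> (?C *v \<phi> y))) \<partial>\<nu>)"
        by (intro nn_integral_mono ennreal_leI le)
      also have "\<dots> = ennreal (\<integral>y. trace ?C + \<beta> * (\<phi> y \<bullet> (?C *v \<phi> y)) \<partial>\<nu>)"
        using expectation_quadratic_form(1)[OF int iso, of ?C] order_trans[OF ge le]
        by (intro nn_integral_eq_integral) auto
      also have "(\<integral>y. trace ?C + \<beta> * (\<phi> y \<bullet> (?C *v \<phi> y)) \<partial>\<nu>) = (1 + \<beta>) * trace ?C"
        using expectation_quadratic_form[OF int iso, of ?C] by (simp add: algebra_simps prob_space)
      also have "ennreal \<dots> = ennreal (1 + \<beta>) * ennreal (f j x)"
        using \<beta> by (simp add: ennreal_mult nonneg f_def)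
      finally show ?thesis .
    qed
    have "(\<integral>\<^sup>+x. ennreal (f (Suc j) x) \<partial>PiM {1..Suc j} (\<lambda>_. \<nu>)) =
        (\<integral>\<^sup>+x. \<integral>\<^sup>+y. ennreal (f (Suc j) (x(Suc j := y))) \<partial>\<nu> \<partial>PiM {1..j} (\<lambda>_. \<nu>))"
      using f_meas[of "Suc j"] unfolding ins by (intro P.product_nn_integral_insert) auto
    also have "\<dots> \<le> (\<integral>\<^sup>+x. ennreal (1 + \<beta>) * ennreal (f j x) \<partial>PiM {1..j} (\<lambda>_. \<nu>))"
      by (intro nn_integral_mono step)
    also have "\<dots> = ennreal (1 + \<beta>) * (\<integral>\<^sup>+x. ennreal (f j x) \<partial>PiM {1..j} (\<lambda>_. \<nu>))"
      using f_meas[of j] by (intro nn_integral_cmult) auto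
    also have "\<dots> \<le> ennreal (1 + \<beta>) * ennreal (real CARD('n) * (1 + \<beta>) ^ j)"
      using Suc unfolding f_def by (intro mult_left_mono) auto
    also have "\<dots> = ennreal (real CARD('n) * (1 + \<beta>) ^ Suc j)"
      using \<beta> by (simp add: ennreal_mult[symmetric] mult_ac)
    finally show ?case unfolding f_def .
  qed
qed

lemma power_tendsto_exp:
  fixes r c :: real
  shows "(\<lambda>k. (1 + r / 2 ^ k - c / (2 ^ k)\<^sup>2) ^ 2 ^ k) \<longlonglongrightarrow> exp r"
proof -
  define y where "y = (\<lambda>k::nat. r / 2 ^ k - c / (2 ^ k)\<^sup>2 :: real)"
  have h: "(\<lambda>k. 1 / 2 ^ k :: real) \<longlonglongrightarrow> 0"
    by (simp add: LIMSEQ_divide_realpow_zero)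
  have y: "y = (\<lambda>k. r * (1 / 2 ^ k) - c * (1 / 2 ^ k) * (1 / 2 ^ k))"
    by (simp add: y_def power2_eq_square)
  have y0: "y \<longlonglongrightarrow> 0"
    unfolding y using tendsto_diff[OF tendsto_mult_right_zero[OF h, of r]
          tendsto_mult[OF tendsto_mult_right_zero[OF h, of c] h]] by simp
  have ky: "(\<lambda>k. 2 ^ k * y k) \<longlonglongrightarrow> r"
  proof -
    have "(\<lambda>k. r - c * (1 / 2 ^ k)) \<longlonglongrightarrow> r"
      using tendsto_diff[OF tendsto_const[of r] tendsto_mult_right_zero[OF h, of c]] by simp
    then show ?thesis by (simp add: y algebra_simps)
  qed
  have ky2: "(\<lambda>k. 2 * (2 ^ k * y k) * y k) \<longlonglongrightarrow> 0"
    using tendsto_mult[OF tendsto_mult[OF tendsto_const[of 2] ky] y0] by simp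
  have small: "\<forall>\<^sub>F k in sequentially. \<bar>y k\<bar> < 1/2"
    using tendstoD[OF y0, of "1/2"] by (simp add: dist_real_def)
  have "(\<lambda>k. 2 ^ k * (ln (1 + y k) - y k)) \<longlonglongrightarrow> 0"
  proof (rule Lim_null_comparison[OF _ ky2])
    show "\<forall>\<^sub>F k in sequentially. norm (2 ^ k * (ln (1 + y k) - y k)) \<le> 2 * (2 ^ k * y k) * y k"
      using small
    proof eventually_elim
      case (elim k)
      have "2 ^ k * \<bar>ln (1 + y k) - y k\<bar> \<le> 2 ^ k * (2 * (y k)\<^sup>2)"
        using elim abs_ln_one_plus_x_minus_x_bound[of "y k"] by (intro mult_left_mono) auto
      then show ?case by (simp add: abs_mult power2_eq_square mult_ac)
    qed
  qed
  from tendsto_add[OF this ky] have "(\<lambda>k. 2 ^ k * ln (1 + y k)) \<longlonglongrightarrow> r"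
    by (simp add: algebra_simps)
  from tendsto_exp[OF this] have "(\<lambda>k. exp (2 ^ k * ln (1 + y k))) \<longlonglongrightarrow> exp r" .
  moreover have "\<forall>\<^sub>F k in sequentially. exp (2 ^ k * ln (1 + y k)) = (1 + r / 2 ^ k - c / (2 ^ k)\<^sup>2) ^ 2 ^ k"
    using small
  proof eventually_elim
    case (elim k)
    then have "0 < 1 + y k" by linarith
    then have "exp (real (2 ^ k) * ln (1 + y k)) = (1 + y k) ^ 2 ^ k"
      by (subst exp_of_nat_mult) simp
    then show ?case by (simp add: y_def add_diff_eq)
  qed
  ultimately show ?thesis by (rule Lim_transform_eventually)
qed

text \<open>
  A positive \<open>t\<close> gives the upper tail and a negative one the lower tail.  The set of samples for which some
  unit vector \<open>w\<close> violates the bound is covered by a measurable set \<open>F\<close>, on which the trace is large;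
  Markov's inequality bounds its probability.  The slack \<open>\<delta>\<close> absorbs the difference between the dyadic
  power and the exponential.
\<close>

lemma one_sided_matrix_chernoff:
  fixes \<phi> :: "'a \<Rightarrow> real^'n" and t \<rho> \<delta> :: real and m :: nat
  assumes "prob_space \<nu>"
    and meas [measurable]: "\<phi> \<in> borel_measurable \<nu>"
    and K: "0 < K" and bound: "\<And>x. x \<in> space \<nu> \<Longrightarrow> \<phi> x \<bullet> \<phi> x \<le> K"
    and iso: "\<And>i j. (\<integral>x. \<phi> x $ i * \<phi> x $ j \<partial>\<nu>) = (if i = j then 1 else 0)"
    and m: "0 < m" and \<delta>: "0 < \<delta>"
  defines "\<beta> \<equiv> (exp (t * K / real m) - 1) / K"
  assumes \<beta>: "0 \<le> 1 + \<beta>"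
  shows "\<exists>F\<in>sets (PiM {1..m} (\<lambda>_. \<nu>)).
    emeasure (PiM {1..m} (\<lambda>_. \<nu>)) F \<le> ennreal (real CARD('n) * exp (real m * \<beta> - t * \<rho>) + \<delta>) \<and>
    (\<forall>x\<in>space (PiM {1..m} (\<lambda>_. \<nu>)). \<forall>w. norm w = 1 \<longrightarrow>
       t * \<rho> \<le> t * ((\<Sum>i\<in>{1..m}. (w \<bullet> \<phi> (x i))\<^sup>2) / m) \<longrightarrow> x \<in> F)"
proof -
  let ?M = "PiM {1..m} (\<lambda>_. \<nu>)"
  obtain C where C: "0 \<le> C" "\<And>a v (w :: real^'n). \<bar>a\<bar> \<le> 1 \<Longrightarrow> (\<forall>i\<in>{1..m}. v i \<bullet> v i \<le> K) \<Longrightarrow>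
      w \<bullet> w + 2 * a * (\<Sum>i\<in>{1..m}. (w \<bullet> v i)\<^sup>2) - a\<^sup>2 * C * (w \<bullet> w) \<le> w \<bullet> (sym_prod a v m *v w)"
    using sym_prod_quadratic_form_bound[of K m, where 'n = 'n] K by (metis less_imp_le)
  define a where "a = (\<lambda>k. t / (2 * real m * 2 ^ k))"
  define q where "q = (\<lambda>k::nat. 1 + t * \<rho> / 2 ^ k - (t\<^sup>2 * C / (4 * (real m)\<^sup>2)) / (2 ^ k)\<^sup>2)"
  have h: "(\<lambda>k. 1 / 2 ^ k :: real) \<longlonglongrightarrow> 0"
    by (simp add: LIMSEQ_divide_realpow_zero)
  have a0: "a \<longlonglongrightarrow> 0"
  proof -
    have "(\<lambda>k. t / (2 * real m) * (1 / 2 ^ k)) \<longlonglongrightarrow> 0"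
      by (rule tendsto_mult_right_zero[OF h])
    then show ?thesis by (simp add: a_def)
  qed
  have q1: "q \<longlonglongrightarrow> 1"
  proof -
    have "(\<lambda>k. 1 + t * \<rho> * (1 / 2 ^ k) - (t\<^sup>2 * C / (4 * (real m)\<^sup>2)) * ((1 / 2 ^ k) * (1 / 2 ^ k))) \<longlonglongrightarrow> 1"
      using tendsto_diff[OF tendsto_add[OF tendsto_const[of 1] tendsto_mult_right_zero[OF h, of "t * \<rho>"]]
          tendsto_mult_right_zero[OF tendsto_mult_zero[OF h h], of "t\<^sup>2 * C / (4 * (real m)\<^sup>2)"]] by simp
    then show ?thesis by (simp add: q_def power2_eq_square)
  qed
  have qexp: "(\<lambda>k. q k ^ 2 ^ k) \<longlonglongrightarrow> exp (t * \<rho>)"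
    unfolding q_def by (rule power_tendsto_exp)
  let ?N = "real CARD('n)"
  have "(\<lambda>k. ?N * exp (real m * \<beta>) / q k ^ 2 ^ k) \<longlonglongrightarrow> ?N * exp (real m * \<beta>) / exp (t * \<rho>)"
    by (intro tendsto_divide tendsto_const qexp) simp
  then have lim: "(\<lambda>k. ?N * exp (real m * \<beta>) / q k ^ 2 ^ k) \<longlonglongrightarrow> ?N * exp (real m * \<beta> - t * \<rho>)"
    by (simp add: exp_diff)
  have "\<forall>\<^sub>F k in sequentially. 0 < k \<and> \<bar>a k\<bar> < min 1 (1 / K) \<and> 0 < q k \<and>
      ?N * exp (real m * \<beta>) / q k ^ 2 ^ k < ?N * exp (real m * \<beta> - t * \<rho>) + \<delta>"
    using eventually_gt_at_top[of "0::nat"] tendstoD[OF a0, of "min 1 (1/K)"] order_tendstoD(1)[OF q1, of 0]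
      order_tendstoD(2)[OF lim, of "?N * exp (real m * \<beta> - t * \<rho>) + \<delta>"] \<delta> K
    by (simp add: dist_real_def eventually_conj_iff)
  then obtain k where k: "0 < k" and ak: "\<bar>a k\<bar> < min 1 (1 / K)" and qk: "0 < q k"
    and final: "?N * exp (real m * \<beta>) / q k ^ 2 ^ k < ?N * exp (real m * \<beta> - t * \<rho>) + \<delta>"
    using eventually_happens'[OF sequentially_bot] by blast
  have small: "\<bar>a k\<bar> * K \<le> 1" using ak K by (simp add: field_simps)
  define f where "f = (\<lambda>x. trace (dyadic_power k (sym_prod (a k) (\<lambda>i. \<phi> (x i)) m)))"
  define F where "F = {x \<in> space ?M. 1 \<le> ennreal (1 / q k ^ 2 ^ k) * ennreal (f x)}"
  have [measurable]: "f \<in> borel_measurable ?M"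
    unfolding f_def by measurable
  have F: "F \<in> sets ?M" unfolding F_def by measurable
  have "emeasure ?M F \<le> ennreal (1 / q k ^ 2 ^ k) * (\<integral>\<^sup>+x. ennreal (f x) \<partial>?M)"
  proof -
    have "emeasure ?M {x \<in> space ?M. 1 \<le> ennreal (1 / q k ^ 2 ^ k) * ennreal (f x)}
        \<le> ennreal (1 / q k ^ 2 ^ k) * (\<integral>\<^sup>+x. ennreal (f x) * indicator (space ?M) x \<partial>?M)"
      by (rule nn_integral_Markov_inequality) measurable
    also have "(\<integral>\<^sup>+x. ennreal (f x) * indicator (space ?M) x \<partial>?M) = (\<integral>\<^sup>+x. ennreal (f x) \<partial>?M)"
      by (intro nn_integral_cong) simp
    finally show ?thesis by (simp add: F_def)
  qed
  also have "\<dots> \<le> ennreal (1 / q k ^ 2 ^ k) * ennreal (?N * (1 + \<beta>) ^ m)"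
    unfolding f_def \<beta>_def using \<beta>
    by (intro mult_left_mono expected_trace_bound[OF \<open>prob_space \<nu>\<close> meas K bound iso _ k _ small])
       (auto simp: m a_def \<beta>_def)
  also have "\<dots> \<le> ennreal (?N * exp (real m * \<beta>) / q k ^ 2 ^ k)"
  proof -
    have "(1 + \<beta>) ^ m \<le> exp \<beta> ^ m" using \<beta> by (intro power_mono exp_ge_add_one_self)
    then have "?N * (1 + \<beta>) ^ m / q k ^ 2 ^ k \<le> ?N * exp (real m * \<beta>) / q k ^ 2 ^ k"
      using qk by (intro divide_right_mono mult_left_mono) (auto simp: exp_of_nat_mult)
    then show ?thesis
      using qk \<beta> by (simp add: ennreal_mult[symmetric] ennreal_leI)
  qed
  also have "\<dots> \<le> ennreal (?N * exp (real m * \<beta> - t * \<rho>) + \<delta>)"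
    using final by (intro ennreal_leI) simp
  finally have 1: "emeasure ?M F \<le> ennreal (?N * exp (real m * \<beta> - t * \<rho>) + \<delta>)" .
  have 2: "x \<in> F" if x: "x \<in> space ?M" and w: "norm w = 1"
    and ge: "t * \<rho> \<le> t * ((\<Sum>i\<in>{1..m}. (w \<bullet> \<phi> (x i))\<^sup>2) / m)" for x and w :: "real^'n"
  proof -
    let ?A = "sym_prod (a k) (\<lambda>i. \<phi> (x i)) m"
    have "\<forall>i\<in>{1..m}. \<phi> (x i) \<bullet> \<phi> (x i) \<le> K"
      using x bound by (auto simp: space_PiM)
    moreover have "w \<bullet> w = 1" using w by (simp add: dot_square_norm)
    ultimately have "1 + 2 * a k * (\<Sum>i\<in>{1..m}. (w \<bullet> \<phi> (x i))\<^sup>2) - (a k)\<^sup>2 * C \<le> w \<bullet> (?A *v w)"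
      using C(2)[of "a k" "\<lambda>i. \<phi> (x i)" w] ak by simp
    moreover have "2 * a k * (\<Sum>i\<in>{1..m}. (w \<bullet> \<phi> (x i))\<^sup>2) \<ge> t * \<rho> / 2 ^ k"
      using divide_right_mono[OF ge, of "2 ^ k"] m by (simp add: a_def field_simps)
    moreover have "(a k)\<^sup>2 * C = (t\<^sup>2 * C / (4 * (real m)\<^sup>2)) / (2 ^ k)\<^sup>2"
      by (simp add: a_def power_divide power_mult_distrib)
    ultimately have qw: "q k \<le> w \<bullet> (?A *v w)"
      unfolding q_def by linarith
    obtain k' where k': "k = Suc k'" using k by (cases k) auto
    have "q k ^ 2 ^ k \<le> (w \<bullet> (?A *v w)) ^ 2 ^ k"
      using qw qk by (intro power_mono) auto
    also have "\<dots> \<le> f x"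
      unfolding f_def using qw qk w unfolding k' by (intro quadratic_form_power_le_trace) auto
    finally have "1 \<le> (1 / q k ^ 2 ^ k) * f x"
      using qk by (simp add: field_simps)
    then have "1 \<le> ennreal (1 / q k ^ 2 ^ k) * ennreal (f x)"
      using qk by (metis ennreal_1 ennreal_leI ennreal_mult' divide_nonneg_pos zero_le_one less_imp_le zero_less_power)
    then show ?thesis using x by (simp add: F_def)
  qed
  from F 1 2 show ?thesis by blast
qed


definition second_moment :: "nat \<Rightarrow> (nat \<Rightarrow> real^'n) \<Rightarrow> real^'n^'n" where
  "second_moment m v = (\<chi> j k. (\<Sum>i\<in>{1..m}. v i $ j * v i $ k) / real m)"

lemma transpose_second_moment [simp]: "transpose (second_moment m v) = second_moment m v"
  by (simp add: second_moment_def transpose_def vec_eq_iff mult.commute)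

lemma second_moment_vector:
  "second_moment m v *v w = (\<Sum>i\<in>{1..m}. (v i \<bullet> w) *\<^sub>R v i) /\<^sub>R real m"
proof (rule vec_eq_iff[THEN iffD2], intro allI)
  fix j
  have "(second_moment m v *v w) $ j = (\<Sum>k\<in>UNIV. \<Sum>i\<in>{1..m}. v i $ j * v i $ k * w $ k / real m)"
    by (simp add: second_moment_def matrix_vector_mult_def sum_divide_distrib sum_distrib_right)
  also have "\<dots> = (\<Sum>i\<in>{1..m}. \<Sum>k\<in>UNIV. v i $ j * v i $ k * w $ k / real m)"
    by (rule sum.swap)
  also have "\<dots> = ((\<Sum>i\<in>{1..m}. (v i \<bullet> w) *\<^sub>R v i) /\<^sub>R real m) $ j"
    by (simp add: inner_vec_def sum_distrib_left sum_distrib_right divide_inverse mult_ac)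
  finally show "(second_moment m v *v w) $ j = ((\<Sum>i\<in>{1..m}. (v i \<bullet> w) *\<^sub>R v i) /\<^sub>R real m) $ j" .
qed

lemma second_moment_quadratic_form:
  "w \<bullet> (second_moment m v *v w) = (\<Sum>i\<in>{1..m}. (w \<bullet> v i)\<^sup>2) / real m"
  by (simp add: second_moment_vector inner_sum_right inner_commute power2_eq_square divide_inverse mult.commute)

text \<open>
  The second inequality says that the Chernoff exponent of the lower tail is at least that of the upper tail,
  which defines \<open>\<gamma>\<close>.  It amounts to \<open>27/4 \<le> e\<^sup>2\<close>.
\<close>

lemma gamma_const_pos: "0 < gamma_const"
  and inverse_gamma_const_le: "inverse gamma_const \<le> 1/2 - ln 2 / 2"
proof -
  have inv: "inverse gamma_const = 3/2 * ln (3/2) - 1/2"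
    by (simp add: gamma_const_def)
  have "1 \<le> ln (3::real)"
    using exp_le ln_ge_iff[of 3 1] by simp
  also have "\<dots> < ln (27/8 :: real)" by simp
  also have "\<dots> = 3 * ln (3/2 :: real)"
    using ln_realpow[of "3/2 :: real" 3] by (simp add: power3_eq_cube)
  finally have "0 < inverse gamma_const" by (simp add: inv)
  then show "0 < gamma_const" by simp
  have "(1625/1000) ^ 4 \<le> exp (1/2 :: real) ^ 4"
    using exp_lower_Taylor_quadratic[of "1/2 :: real"] by (intro power_mono) (auto simp: power2_eq_square)
  also have "\<dots> = exp 2"
    by (simp add: exp_of_nat_mult[symmetric])
  finally have "27/4 \<le> exp (2::real)"
    by (simp add: power4_eq_xxxx)
  then have "ln (27/8 * 2 :: real) \<le> 2"
    using ln_mono[of "27/8 * 2 :: real" "exp 2"] by simp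
  then have "3 * ln (3/2 :: real) + ln 2 \<le> 2"
    using ln_realpow[of "3/2 :: real" 3] ln_mult_pos[of "27/8 :: real" 2] by (simp add: power3_eq_cube)
  then show "inverse gamma_const \<le> 1/2 - ln 2 / 2"
    by (simp add: inv)
qed

lemma chernoff_tail_le:
  fixes n :: nat
  assumes "0 < K" "0 < \<epsilon>" "0 < n" "real m \<ge> gamma_const * K * ln (2 * real n / \<epsilon>)"
    "x \<le> - (real m / K) * inverse gamma_const"
  shows "real n * exp x \<le> \<epsilon> / 2"
proof -
  have "ln (2 * real n / \<epsilon>) \<le> (real m / K) * inverse gamma_const"
    using assms gamma_const_pos by (simp add: field_simps)
  then have "x \<le> - ln (2 * real n / \<epsilon>)" using assms(5) by linarith
  then have "exp x \<le> exp (- ln (2 * real n / \<epsilon>))" by simp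
  also have "\<dots> = \<epsilon> / (2 * real n)"
    using assms by (simp add: exp_minus)
  finally have "real n * exp x \<le> real n * (\<epsilon> / (2 * real n))" by (intro mult_left_mono) auto
  also have "\<dots> = \<epsilon> / 2" using assms by simp
  finally show ?thesis .
qed

text \<open>
  The exponents \<open>t = (m/K) ln (3/2)\<close> and \<open>s = - (m/K) ln 2\<close> are the optimal ones for the thresholds
  \<open>3/2\<close> and \<open>1/2\<close>; each tail then has probability at most \<open>\<epsilon>/2\<close>.
\<close>

theorem matrix_chernoff:
  fixes \<phi> :: "'a \<Rightarrow> real^'n" and m :: nat and K \<epsilon> :: real
  assumes "prob_space \<nu>"
    and meas [measurable]: "\<phi> \<in> borel_measurable \<nu>"
    and bound: "\<And>x. x \<in> space \<nu> \<Longrightarrow> \<phi> x \<bullet> \<phi> x \<le> K"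
    and iso: "\<And>i j. (\<integral>x. \<phi> x $ i * \<phi> x $ j \<partial>\<nu>) = (if i = j then 1 else 0)"
    and \<epsilon>: "0 < \<epsilon>" "\<epsilon> < 1"
    and m: "real m \<ge> gamma_const * K * ln (2 * real CARD('n) / \<epsilon>)"
  shows "emeasure (PiM {1..m} (\<lambda>_. \<nu>))
    {x \<in> space (PiM {1..m} (\<lambda>_. \<nu>)). \<not> spectral_norm (second_moment m (\<lambda>i. \<phi> (x i)) - mat 1) \<le> 1/2} \<le> ennreal \<epsilon>"
    (is "emeasure ?M ?Bad \<le> _")
proof -
  interpret prob_space \<nu> by fact
  have n1: "1 \<le> real CARD('n)" by (simp add: Suc_leI)
  have K1: "1 \<le> K"
  proof -
    fix j :: 'n
    have sq: "\<phi> x $ j * \<phi> x $ j \<le> K" if "x \<in> space \<nu>" for x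
      using bound[OF that] component_le_norm_cart[of "\<phi> x" j]
        mult_mono[OF component_le_norm_cart[of "\<phi> x" j] component_le_norm_cart[of "\<phi> x" j]]
      by (simp add: dot_square_norm power2_eq_square)
    have "(\<integral>x. \<phi> x $ j * \<phi> x $ j \<partial>\<nu>) \<le> (\<integral>x. K \<partial>\<nu>)"
      by (intro integral_mono integrable_const integrable_const_bound[of _ K]) (auto intro!: AE_I2 sq)
    then show "1 \<le> K" by (simp add: iso prob_space)
  qed
  then have K: "0 < K" by simp
  have "\<epsilon> < 2 * real CARD('n)" using \<epsilon> n1 by linarith
  then have "1 < 2 * real CARD('n) / \<epsilon>" using \<epsilon> by (simp add: field_simps)
  then have "0 < gamma_const * K * ln (2 * real CARD('n) / \<epsilon>)"
    using K gamma_const_pos by simp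
  then have mpos: "0 < m" using m by (cases m) auto
  \<comment> \<open>the growth factors of the expected trace are nonnegative because \<open>1 \<le> K\<close>\<close>
  have \<beta>: "0 \<le> 1 + (exp y - 1) / K" for y
    using K1 exp_gt_zero[of y] by (simp add: field_simps del: exp_gt_zero)
  show ?thesis
  proof (rule ennreal_le_epsilon)
    fix e :: real assume e: "0 < e"
    define t s where "t = real m / K * ln (3/2)" and "s = - (real m / K * ln 2)"
    have t: "t * K / real m = ln (3/2)" and s: "s * K / real m = - ln 2"
      using K mpos by (simp_all add: t_def s_def)
    obtain F where F: "F \<in> sets ?M"
      "emeasure ?M F \<le> ennreal (real CARD('n) * exp (real m * ((exp (t * K / real m) - 1) / K) - t * (3/2)) + e / 2)"
      "\<And>x w. x \<in> space ?M \<Longrightarrow> norm w = 1 \<Longrightarrow>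
         t * (3/2) \<le> t * ((\<Sum>i\<in>{1..m}. (w \<bullet> \<phi> (x i))\<^sup>2) / m) \<Longrightarrow> x \<in> F"
      using one_sided_matrix_chernoff[OF \<open>prob_space \<nu>\<close> meas K bound iso mpos _ \<beta>, of "e / 2" t "3/2"] e
      by auto
    obtain F' where F': "F' \<in> sets ?M"
      "emeasure ?M F' \<le> ennreal (real CARD('n) * exp (real m * ((exp (s * K / real m) - 1) / K) - s * (1/2)) + e / 2)"
      "\<And>x w. x \<in> space ?M \<Longrightarrow> norm w = 1 \<Longrightarrow>
         s * (1/2) \<le> s * ((\<Sum>i\<in>{1..m}. (w \<bullet> \<phi> (x i))\<^sup>2) / m) \<Longrightarrow> x \<in> F'"
      using one_sided_matrix_chernoff[OF \<open>prob_space \<nu>\<close> meas K bound iso mpos _ \<beta>, of "e / 2" s "1/2"] e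
      by auto
    have tpos: "0 < t" and sneg: "s < 0"
      using K mpos by (simp_all add: t_def s_def)
    have "?Bad \<subseteq> F \<union> F'"
    proof
      fix x assume "x \<in> ?Bad"
      then have x: "x \<in> space ?M" and "\<not> spectral_norm (second_moment m (\<lambda>i. \<phi> (x i)) - mat 1) \<le> 1/2"
        by auto
      moreover have "transpose (second_moment m (\<lambda>i. \<phi> (x i)) - mat 1) = second_moment m (\<lambda>i. \<phi> (x i)) - mat 1"
        using transpose_second_moment[of m "\<lambda>i. \<phi> (x i)"] transpose_mat[of "1::real"]
        by (simp add: transpose_def vec_eq_iff)
      ultimately obtain w where w: "norm w = 1"
        and "\<not> \<bar>w \<bullet> ((second_moment m (\<lambda>i. \<phi> (x i)) - mat 1) *v w)\<bar> \<le> 1/2"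
        using spectral_norm_le_iff by blast
      then have far: "1/2 < \<bar>(\<Sum>i\<in>{1..m}. (w \<bullet> \<phi> (x i))\<^sup>2) / real m - 1\<bar>"
        by (simp add: matrix_vector_mult_diff_rdistrib inner_diff_right second_moment_quadratic_form dot_square_norm)
      then consider "3/2 \<le> (\<Sum>i\<in>{1..m}. (w \<bullet> \<phi> (x i))\<^sup>2) / real m"
        | "(\<Sum>i\<in>{1..m}. (w \<bullet> \<phi> (x i))\<^sup>2) / real m \<le> 1/2"
        by linarith
      then show "x \<in> F \<union> F'"
      proof cases
        case 1
        then have "x \<in> F" using tpos by (intro F(3)[OF x w] mult_left_mono) auto
        then show ?thesis ..
      next
        case 2
        then have "x \<in> F'" using sneg by (intro F'(3)[OF x w] mult_left_mono_neg) auto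
        then show ?thesis ..
      qed
    qed
    then have "emeasure ?M ?Bad \<le> emeasure ?M (F \<union> F')"
      using F(1) F'(1) by (intro emeasure_mono) auto
    also have "\<dots> \<le> emeasure ?M F + emeasure ?M F'"
      using F(1) F'(1) by (rule emeasure_subadditive)
    also have "\<dots> \<le> ennreal (\<epsilon> / 2 + e / 2) + ennreal (\<epsilon> / 2 + e / 2)"
    proof (rule add_mono)
      have "real CARD('n) * exp (real m * ((exp (t * K / real m) - 1) / K) - t * (3/2)) \<le> \<epsilon> / 2"
        using K by (intro chernoff_tail_le[OF K \<epsilon>(1) _ m])
          (simp_all add: t exp_ln gamma_const_def t_def field_simps)
      then show "emeasure ?M F \<le> ennreal (\<epsilon> / 2 + e / 2)"
        by (intro order_trans[OF F(2)] ennreal_leI) simp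
      have "real CARD('n) * exp (real m * ((exp (s * K / real m) - 1) / K) - s * (1/2)) \<le> \<epsilon> / 2"
      proof (rule chernoff_tail_le[OF K \<epsilon>(1) _ m])
        have "real m * ((exp (s * K / real m) - 1) / K) - s * (1/2) = - ((real m / K) * (1/2 - ln 2 / 2))"
          by (simp add: s exp_minus s_def field_simps)
        also have "\<dots> \<le> - ((real m / K) * inverse gamma_const)"
          using K by (intro le_imp_neg_le mult_left_mono inverse_gamma_const_le) auto
        finally show "real m * ((exp (s * K / real m) - 1) / K) - s * (1/2) \<le> - (real m / K) * inverse gamma_const"
          by simp
      qed simp
      then show "emeasure ?M F' \<le> ennreal (\<epsilon> / 2 + e / 2)"
        by (intro order_trans[OF F'(2)] ennreal_leI) simp
    qed
    also have "\<dots> = ennreal \<epsilon> + ennreal e"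
      using \<epsilon> e by (simp add: ennreal_plus[symmetric] del: ennreal_plus)
    finally show "emeasure ?M ?Bad \<le> ennreal \<epsilon> + ennreal e" .
  qed
qed

section \<open>Matrices close to the identity\<close>

lemma quadratic_form_near_identity:
  fixes G :: "real^'n^'n"
  assumes "spectral_norm (G - mat 1) \<le> 1/2"
  shows "1/2 * (v \<bullet> v) \<le> v \<bullet> (G *v v)" "v \<bullet> (G *v v) \<le> 3/2 * (v \<bullet> v)"
proof -
  have "\<bar>v \<bullet> ((G - mat 1) *v v)\<bar> \<le> norm v * norm ((G - mat 1) *v v)"
    by (rule Cauchy_Schwarz_ineq2)
  also have "\<dots> \<le> norm v * (1/2 * norm v)"
    using onorm[OF matrix_vector_mul_bounded_linear, of "G - mat 1" v] assms
      mult_right_mono[OF assms, of "norm v"]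
    by (intro mult_left_mono) (auto simp: spectral_norm_def)
  also have "\<dots> = 1/2 * (v \<bullet> v)" by (simp add: dot_square_norm power2_eq_square)
  finally have "\<bar>v \<bullet> (G *v v) - v \<bullet> v\<bar> \<le> 1/2 * (v \<bullet> v)"
    by (simp add: matrix_vector_mult_diff_rdistrib inner_diff_right)
  then show "1/2 * (v \<bullet> v) \<le> v \<bullet> (G *v v)" "v \<bullet> (G *v v) \<le> 3/2 * (v \<bullet> v)"
    by linarith+
qed

lemma det_nonzero_near_identity:
  fixes G :: "real^'n^'n"
  assumes "spectral_norm (G - mat 1) \<le> 1/2"
  shows "det G \<noteq> 0"
proof -
  have "v = 0" if "G *v v = 0" for v
    using quadratic_form_near_identity(1)[OF assms, of v] that inner_ge_zero[of v] inner_eq_zero_iff[of v]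
    by simp
  then show ?thesis
    by (metis invertible_det_nz invertible_left_inverse matrix_left_invertible_ker)
qed

text \<open>
  Cramer's rule makes the solution of a linear system visibly a measurable function of its data.
\<close>

definition cramer_solve :: "real^'n^'n \<Rightarrow> real^'n \<Rightarrow> real^'n" where
  "cramer_solve G b = (\<chi> k. det (\<chi> i j. if j = k then b $ i else G $ i $ j) / det G)"

lemma cramer_solve_unique:
  assumes "det G \<noteq> 0"
  shows "G *v x = b \<longleftrightarrow> x = cramer_solve G b"
  using cramer[OF assms, of x b] by (simp add: cramer_solve_def)

lemma borel_measurable_det [measurable (raw)]:
  fixes A :: "'b \<Rightarrow> real^'n^'n"
  assumes [measurable]: "A \<in> borel_measurable N"
  shows "(\<lambda>x. det (A x)) \<in> borel_measurable N"
  unfolding det_def by measurable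

lemma borel_measurable_cramer_solve [measurable (raw)]:
  fixes G :: "'b \<Rightarrow> real^'n^'n"
  assumes [measurable]: "G \<in> borel_measurable N" "b \<in> borel_measurable N"
  shows "(\<lambda>x. cramer_solve (G x) (b x)) \<in> borel_measurable N"
proof (rule borel_measurable_vecI)
  fix k
  have [measurable]: "(\<lambda>x. \<chi> i j. if j = k then b x $ i else G x $ i $ j) \<in> borel_measurable N"
    by (rule borel_measurable_matrixI) (simp, measurable)
  show "(\<lambda>x. cramer_solve (G x) (b x) $ k) \<in> borel_measurable N"
    by (simp add: cramer_solve_def)
qed

lemma borel_measurable_spectral_norm [measurable (raw)]:
  fixes A :: "'b \<Rightarrow> real^'n^'n"
  assumes "A \<in> borel_measurable N"
  shows "(\<lambda>x. spectral_norm (A x)) \<in> borel_measurable N"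
proof (rule borel_measurable_continuous_on[OF _ assms])
  have le: "spectral_norm A \<le> spectral_norm B + (\<Sum>i\<in>UNIV. \<Sum>j\<in>UNIV. \<bar>A $ i $ j - B $ i $ j\<bar>)"
    for A B :: "real^'n^'n"
  proof -
    have "spectral_norm A = onorm (\<lambda>v. B *v v + (A - B) *v v)"
      by (simp add: spectral_norm_def matrix_vector_mult_diff_rdistrib)
    also have "\<dots> \<le> onorm (\<lambda>v. B *v v) + onorm (\<lambda>v. (A - B) *v v)"
      by (intro onorm_triangle matrix_vector_mul_bounded_linear)
    also have "\<dots> \<le> spectral_norm B + (\<Sum>i\<in>UNIV. \<Sum>j\<in>UNIV. \<bar>(A - B) $ i $ j\<bar>)"
      unfolding spectral_norm_def by (intro add_left_mono onorm_le_matrix_component_sum)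
    finally show ?thesis by simp
  qed
  have "spectral_norm \<midarrow>B\<rightarrow> spectral_norm B" for B :: "real^'n^'n"
  proof -
    have "((\<lambda>A. \<Sum>i\<in>UNIV. \<Sum>j\<in>UNIV. \<bar>A $ i $ j - B $ i $ j\<bar>) \<longlongrightarrow>
        (\<Sum>i\<in>UNIV. \<Sum>j\<in>UNIV. \<bar>B $ i $ j - B $ i $ j\<bar>)) (at B)"
      by (intro tendsto_intros)
    then have lim: "((\<lambda>A. \<Sum>i\<in>UNIV. \<Sum>j\<in>UNIV. \<bar>A $ i $ j - B $ i $ j\<bar>) \<longlongrightarrow> 0) (at B)" by simp
    have bound: "norm (spectral_norm A - spectral_norm B) \<le> (\<Sum>i\<in>UNIV. \<Sum>j\<in>UNIV. \<bar>A $ i $ j - B $ i $ j\<bar>)" for A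
    proof -
      have "(\<Sum>i\<in>UNIV. \<Sum>j\<in>UNIV. \<bar>B $ i $ j - A $ i $ j\<bar>) = (\<Sum>i\<in>UNIV. \<Sum>j\<in>UNIV. \<bar>A $ i $ j - B $ i $ j\<bar>)"
        by (intro sum.cong refl abs_minus_commute)
      then show ?thesis using le[of A B] le[of B A] unfolding real_norm_def by linarith
    qed
    have "((\<lambda>A. spectral_norm A - spectral_norm B) \<longlongrightarrow> 0) (at B)"
      by (rule Lim_null_comparison[OF always_eventually lim]) (intro allI bound)
    then show ?thesis by (rule LIM_zero_cancel)
  qed
  then show "continuous_on UNIV (spectral_norm :: real^'n^'n \<Rightarrow> real)"
    by (simp add: continuous_on_eq_continuous_at isCont_def)
qed

lemma borel_measurable_second_moment [measurable (raw)]: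
  fixes v :: "'b \<Rightarrow> nat \<Rightarrow> real^'n"
  assumes "\<And>i. i \<in> {1..m} \<Longrightarrow> (\<lambda>x. v x i) \<in> borel_measurable N"
  shows "(\<lambda>x. second_moment m (v x)) \<in> borel_measurable N"
proof (rule borel_measurable_matrixI)
  fix j k
  have comp: "(\<lambda>x. v x i $ l) \<in> borel_measurable N" if "i \<in> {1..m}" for i l
    using assms[OF that] by (rule borel_measurable_vec_nth)
  have "(\<lambda>x. (\<Sum>i\<in>{1..m}. v x i $ j * v x i $ k) / real m) \<in> borel_measurable N"
    by (rule borel_measurable_divide, rule borel_measurable_sum, rule borel_measurable_times)
      (simp_all add: comp)
  then show "(\<lambda>x. second_moment m (v x) $ j $ k) \<in> borel_measurable N"
    by (simp add: second_moment_def)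
qed


section \<open>Orthonormal systems and least squares\<close>

definition feature :: "('n::finite \<Rightarrow> 'a \<Rightarrow> real) \<Rightarrow> 'a \<Rightarrow> real^'n" where
  "feature L x = (\<chi> j. L j x)"

lemma feature_nth [simp]: "feature L x $ j = L j x"
  by (simp add: feature_def)

lemma christoffel_eq: "christoffel L x = feature L x \<bullet> feature L x"
  by (simp add: christoffel_def inner_vec_def power2_eq_square)

lemma fun_span_iff: "v \<in> fun_span L \<longleftrightarrow> (\<exists>c. v = (\<lambda>x. c \<bullet> feature L x))"
proof
  assume "v \<in> fun_span L"
  then obtain c where "v = (\<lambda>x. \<Sum>j\<in>UNIV. c j * L j x)" by (auto simp: fun_span_def)
  then have "v = (\<lambda>x. (\<chi> j. c j) \<bullet> feature L x)" by (simp add: inner_vec_def)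
  then show "\<exists>c. v = (\<lambda>x. c \<bullet> feature L x)" by blast
next
  assume "\<exists>c. v = (\<lambda>x. c \<bullet> feature L x)"
  then obtain c where "v = (\<lambda>x. c \<bullet> feature L x)" by blast
  then have "v = (\<lambda>x. \<Sum>j\<in>UNIV. c $ j * L j x)" by (simp add: inner_vec_def)
  then show "v \<in> fun_span L" by (auto simp: fun_span_def)
qed

lemma gram_offline_ip:
  "gram (offline_ip M z) L = second_moment M (\<lambda>i. feature L (z i))"
  by (simp add: gram_def offline_ip_def second_moment_def)

lemma gram_online_ip:
  assumes "\<And>i. 0 \<le> w (x i)"
  shows "gram (online_ip m w x) L = second_moment m (\<lambda>i. sqrt (w (x i)) *\<^sub>R feature L (x i))"
proof -
  have eq: "sqrt (w (x i)) * a * (sqrt (w (x i)) * b) = w (x i) * a * b" for i a b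
  proof -
    have "sqrt (w (x i)) * a * (sqrt (w (x i)) * b) = (sqrt (w (x i)) * sqrt (w (x i))) * a * b"
      by (simp only: mult_ac)
    then show ?thesis using assms[of i] by simp
  qed
  show ?thesis
    unfolding gram_def online_ip_def second_moment_def by (simp add: vec_eq_iff eq)
qed

lemma offline_ip_span:
  "offline_ip M z (\<lambda>x. c \<bullet> feature L x) (\<lambda>x. d \<bullet> feature L x) =
     c \<bullet> (second_moment M (\<lambda>i. feature L (z i)) *v d)"
  by (simp add: offline_ip_def second_moment_vector inner_sum_right inner_commute divide_inverse mult.commute)

lemma L2_norm_nonneg: "0 \<le> L2_norm \<mu> f"
  by (simp add: L2_norm_def)

lemma L2_norm_sq: "(L2_norm \<mu> f)\<^sup>2 = (\<integral>x. (f x)\<^sup>2 \<partial>\<mu>)"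
  by (simp add: L2_norm_def)

lemma integrable_L2_mult:
  assumes "f \<in> L2_space \<mu>" "g \<in> L2_space \<mu>"
  shows "integrable \<mu> (\<lambda>x. f x * g x)"
proof (rule Bochner_Integration.integrable_bound)
  show "integrable \<mu> (\<lambda>x. (f x)\<^sup>2 + (g x)\<^sup>2)"
    using assms by (auto simp: L2_space_def)
  show "(\<lambda>x. f x * g x) \<in> borel_measurable \<mu>"
    using assms by (auto simp: L2_space_def)
  have "\<bar>a * b\<bar> \<le> \<bar>a\<^sup>2 + b\<^sup>2\<bar>" for a b :: real
  proof -
    have "2 * (\<bar>a\<bar> * \<bar>b\<bar>) \<le> a\<^sup>2 + b\<^sup>2"
      using sum_squares_bound[of "\<bar>a\<bar>" "\<bar>b\<bar>"] by simp
    moreover have "0 \<le> \<bar>a\<bar> * \<bar>b\<bar>" by simp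
    ultimately show ?thesis unfolding abs_mult by linarith
  qed
  then show "AE x in \<mu>. norm (f x * g x) \<le> norm ((f x)\<^sup>2 + (g x)\<^sup>2)" by simp
qed

lemma L2_space_diff:
  assumes "f \<in> L2_space \<mu>" "g \<in> L2_space \<mu>"
  shows "(\<lambda>x. f x - g x) \<in> L2_space \<mu>"
proof -
  have [measurable]: "f \<in> borel_measurable \<mu>" "g \<in> borel_measurable \<mu>"
    using assms by (auto simp: L2_space_def)
  have "integrable \<mu> (\<lambda>x. (f x)\<^sup>2 + (g x)\<^sup>2 - 2 * (f x * g x))"
    using assms integrable_L2_mult[OF assms] by (auto simp: L2_space_def)
  then have "integrable \<mu> (\<lambda>x. (f x - g x)\<^sup>2)"
    by (simp add: power2_diff mult.assoc)
  then show ?thesis by (simp add: L2_space_def)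
qed

text \<open>
  The variance of a sum of independent centred vectors is additive, since the cross terms integrate to zero.
\<close>

lemma nn_integral_centred_sum:
  fixes \<psi> :: "'a \<Rightarrow> real^'n"
  assumes "prob_space \<nu>" and [measurable]: "\<psi> \<in> borel_measurable \<nu>"
    and int: "\<And>j. integrable \<nu> (\<lambda>x. \<psi> x $ j)" and mean: "\<And>j. (\<integral>x. \<psi> x $ j \<partial>\<nu>) = 0"
    and sq: "integrable \<nu> (\<lambda>x. \<psi> x \<bullet> \<psi> x)"
  shows "(\<integral>\<^sup>+x. ennreal ((\<Sum>i\<in>{1..m}. \<psi> (x i)) \<bullet> (\<Sum>i\<in>{1..m}. \<psi> (x i))) \<partial>PiM {1..m} (\<lambda>_. \<nu>))
    = ennreal (real m * (\<integral>x. \<psi> x \<bullet> \<psi> x \<partial>\<nu>))"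
proof -
  interpret prob_space \<nu> by fact
  interpret P: product_sigma_finite "\<lambda>_::nat. \<nu>"
    by unfold_locales
  have PP: "prob_space (PiM {1..m} (\<lambda>_. \<nu>))" for m :: nat
    by (intro prob_space_PiM \<open>prob_space \<nu>\<close>)
  define S where "S = (\<lambda>m x. \<Sum>i\<in>{1..m::nat}. \<psi> (x i))"
  have S_meas [measurable]: "S m \<in> borel_measurable (PiM {1..m} (\<lambda>_. \<nu>))" for m
    unfolding S_def by (intro borel_measurable_sum) measurable
  define W where "W = (\<integral>x. \<psi> x \<bullet> \<psi> x \<partial>\<nu>)"
  have W: "0 \<le> W" unfolding W_def by (intro integral_nonneg_AE) auto
  have "(\<integral>\<^sup>+x. ennreal (S m x \<bullet> S m x) \<partial>PiM {1..m} (\<lambda>_. \<nu>)) = ennreal (real m * W)"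
  proof (induction m)
    case 0
    then show ?case by (simp add: S_def)
  next
    case (Suc m)
    interpret Q: prob_space "PiM {1..m} (\<lambda>_. \<nu>)" by (rule PP)
    have ins: "{1..Suc m} = insert (Suc m) {1..m}" by auto
    have upd: "S (Suc m) (x(Suc m := y)) = S m x + \<psi> y" for x y
    proof -
      have "(\<Sum>i\<in>{1..m}. \<psi> ((x(Suc m := y)) i)) = (\<Sum>i\<in>{1..m}. \<psi> (x i))"
        by (intro sum.cong) auto
      then show ?thesis by (simp add: S_def)
    qed
    have cross: "integrable \<nu> (\<lambda>y. s \<bullet> \<psi> y)" "(\<integral>y. s \<bullet> \<psi> y \<partial>\<nu>) = 0" for s :: "real^'n"
      by (simp_all add: inner_vec_def int mean)
    have step: "(\<integral>\<^sup>+y. ennreal ((s + \<psi> y) \<bullet> (s + \<psi> y)) \<partial>\<nu>) = ennreal (s \<bullet> s) + ennreal W" for s :: "real^'n"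
    proof -
      have eq: "(s + \<psi> y) \<bullet> (s + \<psi> y) = s \<bullet> s + 2 * (s \<bullet> \<psi> y) + \<psi> y \<bullet> \<psi> y" for y
        by (simp add: inner_add_left inner_add_right inner_commute)
      have "(\<integral>\<^sup>+y. ennreal ((s + \<psi> y) \<bullet> (s + \<psi> y)) \<partial>\<nu>) = ennreal (\<integral>y. (s + \<psi> y) \<bullet> (s + \<psi> y) \<partial>\<nu>)"
      proof (rule nn_integral_eq_integral)
        show "integrable \<nu> (\<lambda>y. (s + \<psi> y) \<bullet> (s + \<psi> y))"
          unfolding eq by (simp add: cross sq)
      qed (intro AE_I2 inner_ge_zero)
      also have "(\<integral>y. (s + \<psi> y) \<bullet> (s + \<psi> y) \<partial>\<nu>) = s \<bullet> s + W"
        unfolding eq by (simp add: cross sq prob_space W_def)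
      finally show ?thesis using W by (simp add: ennreal_plus)
    qed
    have "(\<integral>\<^sup>+x. ennreal (S (Suc m) x \<bullet> S (Suc m) x) \<partial>PiM {1..Suc m} (\<lambda>_. \<nu>)) =
        (\<integral>\<^sup>+x. \<integral>\<^sup>+y. ennreal (S (Suc m) (x(Suc m := y)) \<bullet> S (Suc m) (x(Suc m := y))) \<partial>\<nu> \<partial>PiM {1..m} (\<lambda>_. \<nu>))"
      using S_meas[of "Suc m"] unfolding ins by (intro P.product_nn_integral_insert) auto
    also have "\<dots> = (\<integral>\<^sup>+x. ennreal (S m x \<bullet> S m x) + ennreal W \<partial>PiM {1..m} (\<lambda>_. \<nu>))"
      unfolding upd step ..
    also have "\<dots> = ennreal (real m * W) + ennreal W"
    proof -
      have "(\<integral>\<^sup>+x. ennreal (S m x \<bullet> S m x) + ennreal W \<partial>PiM {1..m} (\<lambda>_. \<nu>)) =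
          (\<integral>\<^sup>+x. ennreal (S m x \<bullet> S m x) \<partial>PiM {1..m} (\<lambda>_. \<nu>)) + (\<integral>\<^sup>+x. ennreal W \<partial>PiM {1..m} (\<lambda>_. \<nu>))"
        using S_meas[of m] by (intro nn_integral_add) auto
      then show ?thesis
        by (simp only: Suc nn_integral_const Q.emeasure_space_1 mult_1_right)
    qed
    also have "\<dots> = ennreal (real (Suc m) * W)"
      using W by (simp add: ennreal_plus[symmetric] algebra_simps del: ennreal_plus)
    finally show ?case .
  qed
  then show ?thesis by (simp add: S_def W_def)
qed

locale orthonormal_system = prob_space \<mu> for \<mu> :: "'a measure" +
  fixes V :: "('a \<Rightarrow> real) set" and L :: "'n::finite \<Rightarrow> 'a \<Rightarrow> real"
  assumes V_L2: "V \<subseteq> L2_space \<mu>" and L_basis: "orthonormal_basis (L2_inner \<mu>) V L"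
begin

lemma V_iff: "v \<in> V \<longleftrightarrow> (\<exists>c. v = (\<lambda>x. c \<bullet> feature L x))"
  using L_basis by (simp add: orthonormal_basis_def fun_span_iff)

lemma span_L2: "(\<lambda>x. c \<bullet> feature L x) \<in> L2_space \<mu>"
  using V_iff V_L2 by blast

lemma L_L2: "L j \<in> L2_space \<mu>"
proof -
  have "L j = (\<lambda>x. axis j 1 \<bullet> feature L x)" by (simp add: inner_axis')
  then show ?thesis using span_L2[of "axis j 1"] by simp
qed

lemma L_measurable [measurable]: "L j \<in> borel_measurable \<mu>"
  using L_L2 by (simp add: L2_space_def)

lemma feature_measurable [measurable]: "feature L \<in> borel_measurable \<mu>"
  by (rule borel_measurable_vecI) simp

lemma integral_L_mult: "(\<integral>x. L i x * L j x \<partial>\<mu>) = (if i = j then 1 else 0)"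
  using L_basis by (simp add: orthonormal_basis_def L2_inner_def)

lemma integral_span_mult: "(\<integral>x. (c \<bullet> feature L x) * (d \<bullet> feature L x) \<partial>\<mu>) = c \<bullet> d"
proof -
  have "(\<integral>x. (c \<bullet> feature L x) * (d \<bullet> feature L x) \<partial>\<mu>) =
      (\<integral>x. (\<Sum>i\<in>UNIV. \<Sum>j\<in>UNIV. c $ i * d $ j * (L i x * L j x)) \<partial>\<mu>)"
    by (simp add: inner_vec_def sum_product mult_ac)
  also have "\<dots> = (\<Sum>i\<in>UNIV. \<Sum>j\<in>UNIV. c $ i * d $ j * (if i = j then 1 else 0))"
    by (simp add: integrable_L2_mult[OF L_L2 L_L2] integral_L_mult del: mult_cancel_left1)
  also have "\<dots> = c \<bullet> d" by (simp add: inner_vec_def if_distrib[of "\<lambda>x. _ * x"] cong: if_cong)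
  finally show ?thesis .
qed

definition proj_coeff :: "('a \<Rightarrow> real) \<Rightarrow> real^'n" where
  "proj_coeff u = (\<chi> j. \<integral>x. u x * L j x \<partial>\<mu>)"

definition residual :: "('a \<Rightarrow> real) \<Rightarrow> 'a \<Rightarrow> real" where
  "residual u x = u x - proj_coeff u \<bullet> feature L x"

lemma residual_L2: "u \<in> L2_space \<mu> \<Longrightarrow> residual u \<in> L2_space \<mu>"
  using L2_space_diff[OF _ span_L2] unfolding residual_def[abs_def] by blast

lemma integral_residual_span:
  assumes "u \<in> L2_space \<mu>"
  shows "(\<integral>x. residual u x * (c \<bullet> feature L x) \<partial>\<mu>) = 0"
proof -
  have "(\<integral>x. u x * (c \<bullet> feature L x) \<partial>\<mu>) = (\<integral>x. (\<Sum>j\<in>UNIV. c $ j * (u x * L j x)) \<partial>\<mu>)"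
    by (simp add: inner_vec_def sum_distrib_left mult_ac)
  also have "\<dots> = proj_coeff u \<bullet> c"
    by (simp add: integrable_L2_mult[OF assms L_L2] proj_coeff_def inner_vec_def mult.commute)
  finally have 1: "(\<integral>x. u x * (c \<bullet> feature L x) \<partial>\<mu>) = proj_coeff u \<bullet> c" .
  have "(\<integral>x. residual u x * (c \<bullet> feature L x) \<partial>\<mu>) =
      (\<integral>x. u x * (c \<bullet> feature L x) - (proj_coeff u \<bullet> feature L x) * (c \<bullet> feature L x) \<partial>\<mu>)"
    by (simp add: residual_def left_diff_distrib)
  also have "\<dots> = 0"
    by (simp add: integrable_L2_mult[OF assms span_L2] integrable_L2_mult[OF span_L2 span_L2] 1 integral_span_mult)
  finally show ?thesis .
qed

lemma integral_residual_L:
  assumes "u \<in> L2_space \<mu>"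
  shows "(\<integral>x. residual u x * L j x \<partial>\<mu>) = 0"
  using integral_residual_span[OF assms, of "axis j 1"] by (simp add: inner_axis')

lemma L2_error_pythagoras:
  assumes u: "u \<in> L2_space \<mu>"
  shows "(L2_norm \<mu> (\<lambda>x. u x - c \<bullet> feature L x))\<^sup>2 =
    (L2_norm \<mu> (residual u))\<^sup>2 + (c - proj_coeff u) \<bullet> (c - proj_coeff u)"
proof -
  let ?d = "c - proj_coeff u"
  have "(u x - c \<bullet> feature L x)\<^sup>2 =
      (residual u x)\<^sup>2 - 2 * (residual u x * (?d \<bullet> feature L x)) + (?d \<bullet> feature L x) * (?d \<bullet> feature L x)" for x
    by (simp add: residual_def inner_diff_left power2_eq_square algebra_simps)
  moreover have "integrable \<mu> (\<lambda>x. (residual u x)\<^sup>2)"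
    using residual_L2[OF u] by (simp add: L2_space_def)
  ultimately show ?thesis
    by (simp add: L2_norm_sq integrable_L2_mult[OF residual_L2[OF u] span_L2]
        integrable_L2_mult[OF span_L2 span_L2] integral_residual_span[OF u] integral_span_mult)
qed

lemma residual_le_best_error:
  assumes u: "u \<in> L2_space \<mu>"
  shows "L2_norm \<mu> (residual u) \<le> best_error \<mu> V u"
  unfolding best_error_def
proof (rule cINF_greatest)
  show "V \<noteq> {}" using V_iff by blast
  fix v assume "v \<in> V"
  then obtain c where v: "v = (\<lambda>x. c \<bullet> feature L x)" using V_iff by blast
  have "(L2_norm \<mu> (residual u))\<^sup>2 \<le> (L2_norm \<mu> (\<lambda>x. u x - v x))\<^sup>2"
    unfolding v L2_error_pythagoras[OF u] by simp
  then show "L2_norm \<mu> (residual u) \<le> L2_norm \<mu> (\<lambda>x. u x - v x)"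
    using L2_norm_nonneg by (rule power2_le_imp_le)
qed

text \<open>
  The normal equations, written for the deviation from the \<open>L\<^sup>2\<close> projection: only the residual of \<open>u\<close>
  enters the right-hand side.  They come from moving the minimiser in the direction \<open>e\<close> of steepest descent.
\<close>

lemma least_squares_coeff:
  assumes w: "\<And>i. 0 \<le> w i" and m: "0 < m"
    and min: "\<And>c'. (\<Sum>i\<in>{1..m}. w i * (u (x i) - c \<bullet> feature L (x i))\<^sup>2)
      \<le> (\<Sum>i\<in>{1..m}. w i * (u (x i) - c' \<bullet> feature L (x i))\<^sup>2)"
  shows "second_moment m (\<lambda>i. sqrt (w i) *\<^sub>R feature L (x i)) *v (c - proj_coeff u)
    = (\<Sum>i\<in>{1..m}. (w i * residual u (x i)) *\<^sub>R feature L (x i)) /\<^sub>R real m"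
proof -
  define r where "r = (\<lambda>i. u (x i) - c \<bullet> feature L (x i))"
  define e where "e = (\<Sum>i\<in>{1..m}. (w i * r i) *\<^sub>R feature L (x i))"
  define A where "A = (\<Sum>i\<in>{1..m}. w i * (e \<bullet> feature L (x i))\<^sup>2)"
  have ee: "(\<Sum>i\<in>{1..m}. w i * r i * (e \<bullet> feature L (x i))) = e \<bullet> e"
    using inner_sum_right[of e "\<lambda>i. (w i * r i) *\<^sub>R feature L (x i)" "{1..m}"]
    unfolding e_def[symmetric] by simp
  have ineq: "2 * s * (e \<bullet> e) \<le> s\<^sup>2 * A" for s
  proof -
    have "(\<Sum>i\<in>{1..m}. w i * (r i)\<^sup>2) \<le> (\<Sum>i\<in>{1..m}. w i * (r i - s * (e \<bullet> feature L (x i)))\<^sup>2)"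
      using min[of "c + s *\<^sub>R e"] by (simp add: r_def inner_add_left diff_diff_eq)
    also have "\<dots> = (\<Sum>i\<in>{1..m}. w i * (r i)\<^sup>2 - 2 * s * (w i * r i * (e \<bullet> feature L (x i)))
        + s\<^sup>2 * (w i * (e \<bullet> feature L (x i))\<^sup>2))"
      by (intro sum.cong refl) (simp add: power2_eq_square algebra_simps)
    also have "\<dots> = (\<Sum>i\<in>{1..m}. w i * (r i)\<^sup>2) - 2 * s * (e \<bullet> e) + s\<^sup>2 * A"
      by (simp only: sum.distrib sum_subtractf sum_distrib_left[symmetric] ee A_def)
    finally show ?thesis by simp
  qed
  have "e \<bullet> e = 0"
  proof (rule ccontr)
    assume "e \<bullet> e \<noteq> 0"
    then have pos: "0 < e \<bullet> e" using inner_ge_zero[of e] by linarith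
    have A: "0 \<le> A" unfolding A_def using w by (intro sum_nonneg mult_nonneg_nonneg) auto
    \<comment> \<open>a step size small enough for the linear gain to beat the quadratic loss, also when \<open>A = 0\<close>\<close>
    define s where "s = (e \<bullet> e) / (A + 1)"
    have s: "0 < s" using pos A by (simp add: s_def)
    have "2 * (e \<bullet> e) \<le> s * A"
      using ineq[of s] s by (simp add: power2_eq_square mult_ac)
    also have "s * A \<le> e \<bullet> e"
      using A pos by (simp add: s_def field_simps)
    finally show False using pos by simp
  qed
  then have e0: "e = 0" by simp
  have r: "r i = residual u (x i) - (c - proj_coeff u) \<bullet> feature L (x i)" for i
    by (simp add: r_def residual_def inner_diff_left)
  have "e = (\<Sum>i\<in>{1..m}. (w i * residual u (x i)) *\<^sub>R feature L (x i))
      - (\<Sum>i\<in>{1..m}. (w i * ((c - proj_coeff u) \<bullet> feature L (x i))) *\<^sub>R feature L (x i))"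
    by (simp add: e_def r right_diff_distrib scaleR_diff_left sum_subtractf)
  with e0 have "(\<Sum>i\<in>{1..m}. (w i * ((c - proj_coeff u) \<bullet> feature L (x i))) *\<^sub>R feature L (x i))
      = (\<Sum>i\<in>{1..m}. (w i * residual u (x i)) *\<^sub>R feature L (x i))" by simp
  moreover have eq: "sqrt (w i) * (sqrt (w i) * a) = w i * a" for i a
    using w[of i] by (simp flip: mult.assoc)
  ultimately show ?thesis
    by (simp add: second_moment_vector inner_commute[of "feature L _"] mult.commute[of _ "sqrt _"] eq)
qed

end

lemma near_identity_solution_bound:
  fixes G :: "real^'n^'n"
  assumes "spectral_norm (G - mat 1) \<le> 1/2" and "G *v d = b"
  shows "d \<bullet> d \<le> 4 * (b \<bullet> b)"
proof -
  have "1/2 * (d \<bullet> d) \<le> d \<bullet> b"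
    using quadratic_form_near_identity(1)[OF assms(1), of d] assms(2) by simp
  also have "\<dots> \<le> norm d * norm b" by (rule norm_cauchy_schwarz)
  finally have "norm d * norm d \<le> norm d * (2 * norm b)" by (simp add: dot_square_norm power2_eq_square)
  then have "norm d \<le> 2 * norm b"
    by (cases "d = 0") simp_all
  then have "(norm d)\<^sup>2 \<le> (2 * norm b)\<^sup>2" by (intro power_mono) auto
  then show ?thesis by (simp add: dot_square_norm power_mult_distrib)
qed


section \<open>The empirical Christoffel function\<close>

context orthonormal_system
begin

abbreviation empirical_gram :: "nat \<Rightarrow> (nat \<Rightarrow> 'a) \<Rightarrow> real^'n^'n" where
  "empirical_gram M z \<equiv> second_moment M (\<lambda>i. feature L (z i))"

text \<open>
  The Christoffel function of any basis that is orthonormal for the empirical inner product, expressed through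
  the Gram matrix of \<open>L\<close>.  Unlike the chosen basis, this expression is measurable in the sample \<open>z\<close>.
\<close>

definition empirical_christoffel :: "nat \<Rightarrow> (nat \<Rightarrow> 'a) \<Rightarrow> 'a \<Rightarrow> real" where
  "empirical_christoffel M z y = feature L y \<bullet> cramer_solve (empirical_gram M z) (feature L y)"

definition empirical_weight :: "nat \<Rightarrow> (nat \<Rightarrow> 'a) \<Rightarrow> 'a \<Rightarrow> real" where
  "empirical_weight M z y =
     (\<integral>y. empirical_christoffel M z y \<partial>\<mu>) / empirical_christoffel M z y"

definition online_gram :: "nat \<Rightarrow> (nat \<Rightarrow> 'a) \<Rightarrow> nat \<Rightarrow> (nat \<Rightarrow> 'a) \<Rightarrow> real^'n^'n" where
  "online_gram M z m x =
     second_moment m (\<lambda>i. sqrt (empirical_weight M z (x i)) *\<^sub>R feature L (x i))"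

text \<open>
  The right-hand side of the normal equations for the deviation from the projection.  Its mean is zero,
  since the residual is orthogonal to \<open>V\<close>.
\<close>

definition noise :: "nat \<Rightarrow> (nat \<Rightarrow> 'a) \<Rightarrow> ('a \<Rightarrow> real) \<Rightarrow> nat \<Rightarrow> (nat \<Rightarrow> 'a) \<Rightarrow> real^'n" where
  "noise M z u m x =
     (\<Sum>i\<in>{1..m}. (empirical_weight M z (x i) * residual u (x i)) *\<^sub>R feature L (x i)) /\<^sub>R real m"

definition offline_stable :: "nat \<Rightarrow> (nat \<Rightarrow> 'a) \<Rightarrow> bool" where
  "offline_stable M z \<longleftrightarrow> spectral_norm (empirical_gram M z - mat 1) \<le> 1/2"

lemma offline_stable_inner_product:
  assumes "offline_stable M z"
  shows "inner_product_on V (offline_ip M z)"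
  unfolding inner_product_on_def
proof (intro ballI impI)
  fix v assume "v \<in> V" and nz: "v \<noteq> (\<lambda>_. 0)"
  then obtain c where v: "v = (\<lambda>x. c \<bullet> feature L x)" using V_iff by blast
  with nz have "c \<noteq> 0" by auto
  then have "0 < 1/2 * (c \<bullet> c)" by simp
  also have "\<dots> \<le> c \<bullet> (empirical_gram M z *v c)"
    using assms by (intro quadratic_form_near_identity(1)) (simp add: offline_stable_def)
  finally show "0 < offline_ip M z v v"
    unfolding v offline_ip_span .
qed

text \<open>
  If \<open>C\<close> is the matrix of the change of basis, orthonormality says \<open>C G C\<^sup>T = I\<close>, and therefore
  \<open>C\<^sup>T C\<close> is the inverse of \<open>G\<close>.
\<close>

lemma offline_basis_matrix:
  fixes Lt :: "'n \<Rightarrow> 'a \<Rightarrow> real"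
  assumes "orthonormal_basis (offline_ip M z) V Lt"
  obtains C where "\<And>x. feature Lt x = C *v feature L x"
    "\<And>k. C $ k \<bullet> (empirical_gram M z *v C $ k) = 1"
    "empirical_gram M z ** (transpose C ** C) = mat 1"
proof -
  have V: "V = fun_span Lt"
    and ip: "\<And>j k. offline_ip M z (Lt j) (Lt k) = (if j = k then 1 else 0)"
    using assms by (auto simp: orthonormal_basis_def)
  have "\<exists>c. Lt k = (\<lambda>x. c \<bullet> feature L x)" for k
  proof -
    have "Lt k = (\<lambda>x. axis k 1 \<bullet> feature Lt x)" by (simp add: inner_axis')
    then have "Lt k \<in> V" unfolding V fun_span_iff by blast
    then show ?thesis using V_iff by blast
  qed
  then obtain c where c: "\<And>k. Lt k = (\<lambda>x. c k \<bullet> feature L x)" by metis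
  define C where "C = (\<chi> k. c k)"
  define G where "G = empirical_gram M z"
  have entry: "c j \<bullet> (G *v c k) = (if j = k then 1 else 0)" for j k
    using ip[of j k] unfolding c offline_ip_span G_def .
  have "C ** (G ** transpose C) = mat 1"
  proof -
    have "(C ** (G ** transpose C)) $ j $ k = c j \<bullet> (G *v c k)" for j k
      by (simp add: C_def matrix_matrix_mult_def matrix_vector_mult_def transpose_def inner_vec_def)
    then show ?thesis by (simp add: vec_eq_iff mat_def entry)
  qed
  then have "(G ** transpose C) ** C = mat 1"
    using matrix_left_right_inverse[of C "G ** transpose C"] by simp
  then have 3: "G ** (transpose C ** C) = mat 1"
    by (simp add: matrix_mul_assoc)
  have 1: "feature Lt x = C *v feature L x" for x
    by (simp add: vec_eq_iff c C_def matrix_vector_mult_def inner_vec_def)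
  have 2: "C $ k \<bullet> (G *v C $ k) = 1" for k
    using entry[of k k] by (simp add: C_def)
  show ?thesis using that[OF 1] 2 3 unfolding G_def by blast
qed

text \<open>
  The eigenvalues of \<open>G\<close> lie between \<open>1/2\<close> and \<open>3/2\<close>.  The upper one bounds \<open>\<bar>f\<bar>\<^sup>2\<close> by
  \<open>3/2 f\<^sup>T G\<^sup>-\<^sup>1 f\<close>, through the Cauchy-Schwarz inequality in the inner product given by \<open>G\<^sup>-\<^sup>1 = C\<^sup>T C\<close>.
  The lower one shows that each empirically normalised basis function has \<open>L\<^sup>2\<close> norm squared at most \<open>2\<close>.
\<close>

lemma christoffel_bounds:
  fixes Lt :: "'n \<Rightarrow> 'a \<Rightarrow> real"
  assumes stable: "offline_stable M z" and basis: "orthonormal_basis (offline_ip M z) V Lt"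
  shows "christoffel Lt y = empirical_christoffel M z y"
    and "christoffel L y \<le> 3/2 * empirical_christoffel M z y"
    and "integrable \<mu> (empirical_christoffel M z)"
    and "0 < (\<integral>y. empirical_christoffel M z y \<partial>\<mu>)"
    and "(\<integral>y. empirical_christoffel M z y \<partial>\<mu>) \<le> 2 * real CARD('n)"
proof -
  define G where "G = empirical_gram M z"
  have G: "spectral_norm (G - mat 1) \<le> 1/2"
    using stable by (simp add: G_def offline_stable_def)
  obtain C where C: "\<And>x. feature Lt x = C *v feature L x"
    "\<And>k. C $ k \<bullet> (G *v C $ k) = 1" "G ** (transpose C ** C) = mat 1"
    using offline_basis_matrix[OF basis] unfolding G_def by metis
  have solve: "cramer_solve G b = (transpose C ** C) *v b" for b
    using cramer_solve_unique[OF det_nonzero_near_identity[OF G], of "(transpose C ** C) *v b" b] C(3)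
    by (simp add: matrix_vector_mul_assoc del: transpose_matrix_vector)
  have eq: "christoffel Lt y = empirical_christoffel M z y" for y
    by (simp only: christoffel_eq C(1) empirical_christoffel_def G_def[symmetric] solve inner_transpose_mult)
  show "christoffel Lt y = empirical_christoffel M z y" by (rule eq)
  show "christoffel L y \<le> 3/2 * empirical_christoffel M z y"
  proof -
    define f where "f = feature L y"
    have symG: "transpose G = G" by (simp add: G_def)
    have CG: "(C *v (G *v f)) \<bullet> (C *v x) = f \<bullet> x" for x
    proof -
      have "(C *v (G *v f)) \<bullet> (C *v x) = (G *v f) \<bullet> ((transpose C ** C) *v x)"
        by (rule inner_transpose_mult[symmetric])
      also have "\<dots> = (transpose G *v f) \<bullet> ((transpose C ** C) *v x)" by (simp only: symG)
      also have "\<dots> = f \<bullet> (G *v ((transpose C ** C) *v x))"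
        by (simp add: dot_lmul_matrix)
      also have "\<dots> = f \<bullet> x"
        by (simp add: matrix_vector_mul_assoc C(3) del: transpose_matrix_vector)
      finally show ?thesis .
    qed
    have "(f \<bullet> f)\<^sup>2 = ((C *v (G *v f)) \<bullet> (C *v f))\<^sup>2" by (simp add: CG)
    also have "\<dots> \<le> ((C *v (G *v f)) \<bullet> (C *v (G *v f))) * ((C *v f) \<bullet> (C *v f))"
      by (rule Cauchy_Schwarz_ineq)
    also have "\<dots> = (f \<bullet> (G *v f)) * ((C *v f) \<bullet> (C *v f))" by (simp add: CG)
    also have "\<dots> \<le> (3/2 * (f \<bullet> f)) * ((C *v f) \<bullet> (C *v f))"
      by (intro mult_right_mono quadratic_form_near_identity(2)[OF G]) simp
    finally have "(f \<bullet> f) * (f \<bullet> f) \<le> (f \<bullet> f) * (3/2 * ((C *v f) \<bullet> (C *v f)))"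
      by (simp add: power2_eq_square mult_ac)
    then have "f \<bullet> f \<le> 3/2 * ((C *v f) \<bullet> (C *v f))"
      by (cases "f = 0") (simp_all add: mult_le_cancel_left)
    then show ?thesis
      by (simp add: christoffel_eq f_def eq[symmetric] C(1))
  qed
  have sum_eq: "empirical_christoffel M z y = (\<Sum>k\<in>UNIV. (C $ k \<bullet> feature L y) * (C $ k \<bullet> feature L y))" for y
    unfolding eq[symmetric] christoffel_eq C(1) by (simp add: inner_vec_def matrix_vector_mult_def)
  show "integrable \<mu> (empirical_christoffel M z)"
    unfolding sum_eq[abs_def] by (intro Bochner_Integration.integrable_sum integrable_L2_mult span_L2)
  have int: "(\<integral>y. empirical_christoffel M z y \<partial>\<mu>) = (\<Sum>k\<in>UNIV. C $ k \<bullet> C $ k)"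
    unfolding sum_eq by (simp add: integrable_L2_mult[OF span_L2 span_L2] integral_span_mult)
  have row: "0 < C $ k \<bullet> C $ k" "C $ k \<bullet> C $ k \<le> 2" for k
    using quadratic_form_near_identity[OF G, of "C $ k"] C(2)[of k] by linarith+
  show "0 < (\<integral>y. empirical_christoffel M z y \<partial>\<mu>)"
    unfolding int by (intro sum_pos row) auto
  have "(\<Sum>k\<in>UNIV. C $ k \<bullet> C $ k) \<le> (\<Sum>k\<in>(UNIV::'n set). 2)"
    by (intro sum_mono row)
  then show "(\<integral>y. empirical_christoffel M z y \<partial>\<mu>) \<le> 2 * real CARD('n)"
    unfolding int by simp
qed

end

section \<open>The online stage for a fixed stable offline sample\<close>

locale online_stage = orthonormal_system \<mu> V L for \<mu> :: "'a measure" and V and L :: "'n::finite \<Rightarrow> 'a \<Rightarrow> real" +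
  fixes M :: nat and z :: "nat \<Rightarrow> 'a" and Lt :: "'n \<Rightarrow> 'a \<Rightarrow> real"
  assumes stable: "offline_stable M z"
    and basis: "orthonormal_basis (offline_ip M z) V Lt"
    and prob_sampling: "prob_space (sampling_measure \<mu> Lt)"
begin

abbreviation "\<kappa> \<equiv> empirical_christoffel M z"
abbreviation "W \<equiv> (\<integral>y. empirical_christoffel M z y \<partial>\<mu>)"
abbreviation "w \<equiv> empirical_weight M z"
abbreviation "\<sigma> \<equiv> sampling_measure \<mu> Lt"

lemmas \<kappa> = christoffel_bounds[OF stable basis]

lemma \<kappa>_nonneg: "0 \<le> \<kappa> y"
  using \<kappa>(1)[of y] by (simp add: christoffel_eq flip: \<kappa>(1))

lemma \<kappa>_measurable [measurable]: "\<kappa> \<in> borel_measurable \<mu>"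
  using \<kappa>(3) by auto

lemma norm_factor_eq: "norm_factor \<mu> Lt = real CARD('n) / W"
  unfolding norm_factor_def \<kappa>(1) ..

lemma weight_eq: "weight \<mu> Lt = w"
  unfolding weight_def norm_factor_eq \<kappa>(1) empirical_weight_def[abs_def] using \<kappa>(4)
  by (simp add: fun_eq_iff)

lemma sampling_eq: "\<sigma> = density \<mu> (\<lambda>y. ennreal (\<kappa> y / W))"
  unfolding sampling_measure_def norm_factor_eq \<kappa>(1) by simp

lemma w_nonneg: "0 \<le> w y"
  unfolding empirical_weight_def using \<kappa>(4) \<kappa>_nonneg by simp

lemma w_measurable [measurable]: "w \<in> borel_measurable \<mu>"
  unfolding empirical_weight_def[abs_def] by measurable

text \<open>
  The two bounds on the empirical Christoffel function \<open>\<kappa>\<close> combine: the weight is \<open>W / \<kappa>\<close> with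
  \<open>W \<le> 2 n\<close>, and the true Christoffel function is at most \<open>3/2 \<kappa>\<close>.
\<close>

lemma w_christoffel_le: "w y * (feature L y \<bullet> feature L y) \<le> 3 * real CARD('n)"
proof (cases "\<kappa> y = 0")
  case True
  then show ?thesis by (simp add: empirical_weight_def)
next
  case False
  then have pos: "0 < \<kappa> y" using \<kappa>_nonneg[of y] by simp
  have "w y * (feature L y \<bullet> feature L y) \<le> W / \<kappa> y * (3/2 * \<kappa> y)"
    unfolding empirical_weight_def christoffel_eq[symmetric]
    using pos \<kappa>(4) by (intro mult_left_mono \<kappa>(2)) auto
  also have "\<dots> = 3/2 * W" using pos by simp
  also have "\<dots> \<le> 3 * real CARD('n)" using \<kappa>(5) by simp
  finally show ?thesis .
qed

lemma feature_eq_0: "\<kappa> y = 0 \<Longrightarrow> feature L y = 0"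
  using \<kappa>(2)[of y] inner_ge_zero[of "feature L y"] inner_eq_zero_iff[of "feature L y"]
  by (simp add: christoffel_eq)

text \<open>
  The weight cancels the density of the sampling measure, except where the empirical Christoffel function
  vanishes.  At such points all functions of \<open>V\<close> vanish, and so does every product \<open>h\<close> that has one of
  them as a factor.
\<close>

lemma integral_sampling:
  fixes h :: "'a \<Rightarrow> real"
  assumes h: "integrable \<mu> h" and zero: "\<And>y. \<kappa> y = 0 \<Longrightarrow> h y = 0"
  shows "integrable \<sigma> (\<lambda>y. w y * h y)" "(\<integral>y. w y * h y \<partial>\<sigma>) = (\<integral>y. h y \<partial>\<mu>)"
proof -
  have [measurable]: "h \<in> borel_measurable \<mu>" using h by auto
  have eq: "\<kappa> y * (w y * h y) / W = h y" for y
    using zero[of y] \<kappa>(4) by (cases "\<kappa> y = 0") (simp_all add: empirical_weight_def)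
  have nn: "AE y in \<mu>. 0 \<le> \<kappa> y / W" using \<kappa>(4) \<kappa>_nonneg by simp
  show "integrable \<sigma> (\<lambda>y. w y * h y)"
    unfolding sampling_eq using nn h by (subst integrable_density) (auto simp: eq)
  show "(\<integral>y. w y * h y \<partial>\<sigma>) = (\<integral>y. h y \<partial>\<mu>)"
    unfolding sampling_eq using nn by (subst integral_density) (auto simp: eq)
qed

lemma sets_sampling [measurable_cong]: "sets \<sigma> = sets \<mu>"
  by (simp add: sampling_eq)

lemma gram_online_eq: "gram (online_ip m (weight \<mu> Lt) x) L = online_gram M z m x"
  unfolding weight_eq online_gram_def by (rule gram_online_ip) (rule w_nonneg)

lemma online_chernoff:
  assumes "0 < \<epsilon>" "\<epsilon> < 1"
    and "real m \<ge> 3 * gamma_const * real CARD('n) * ln (2 * real CARD('n) / \<epsilon>)"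
  shows "emeasure (PiM {1..m} (\<lambda>_. \<sigma>))
    {x \<in> space (PiM {1..m} (\<lambda>_. \<sigma>)). \<not> spectral_norm (online_gram M z m x - mat 1) \<le> 1/2} \<le> ennreal \<epsilon>"
  unfolding online_gram_def
proof (rule matrix_chernoff[of \<sigma> "\<lambda>y. sqrt (w y) *\<^sub>R feature L y" "3 * real CARD('n)"])
  show "prob_space \<sigma>" by (rule prob_sampling)
  show "(\<lambda>y. sqrt (w y) *\<^sub>R feature L y) \<in> borel_measurable \<sigma>" by measurable
  have sq: "sqrt (w y) * (sqrt (w y) * a) = w y * a" for y a
    using w_nonneg[of y] by (simp flip: mult.assoc)
  show "(sqrt (w y) *\<^sub>R feature L y) \<bullet> (sqrt (w y) *\<^sub>R feature L y) \<le> 3 * real CARD('n)" for y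
    using w_christoffel_le[of y] by (simp add: sq)
  show "(\<integral>y. (sqrt (w y) *\<^sub>R feature L y) $ i * (sqrt (w y) *\<^sub>R feature L y) $ j \<partial>\<sigma>) = (if i = j then 1 else 0)" for i j
  proof -
    have eq: "(sqrt (w y) *\<^sub>R feature L y) $ i * (sqrt (w y) *\<^sub>R feature L y) $ j = w y * (L i y * L j y)" for y
    proof -
      have "(sqrt (w y) *\<^sub>R feature L y) $ i * (sqrt (w y) *\<^sub>R feature L y) $ j
          = sqrt (w y) * (sqrt (w y) * (L i y * L j y))"
        by (simp add: mult_ac)
      then show ?thesis by (simp only: sq)
    qed
    have zero: "L i y * L j y = 0" if "\<kappa> y = 0" for y
      using feature_eq_0[OF that] feature_nth[of L y i] by simp
    have "(\<integral>y. w y * (L i y * L j y) \<partial>\<sigma>) = (\<integral>y. L i y * L j y \<partial>\<mu>)"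
      by (rule integral_sampling(2)[OF integrable_L2_mult[OF L_L2 L_L2] zero])
    then show ?thesis
      unfolding eq integral_L_mult .
  qed
  show "gamma_const * (3 * real CARD('n)) * ln (2 * real CARD('n) / \<epsilon>) \<le> real m"
    using assms(3) by (simp add: mult_ac)
qed (rule assms)+

lemma noise_measurable [measurable]:
  assumes "u \<in> L2_space \<mu>"
  shows "noise M z u m \<in> borel_measurable (PiM {1..m} (\<lambda>_. \<sigma>))"
proof -
  have [measurable]: "residual u \<in> borel_measurable \<mu>"
    using residual_L2[OF assms] by (simp add: L2_space_def)
  show ?thesis
    unfolding noise_def[abs_def] by (intro borel_measurable_scaleR borel_measurable_const borel_measurable_sum) measurable
qed

text \<open>
  One weight turns the sampling measure back into \<open>\<mu>\<close>, and the other one, together with the Christoffel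
  function, is bounded by \<open>3 n\<close>.
\<close>

lemma expected_noise:
  assumes u: "u \<in> L2_space \<mu>" and m: "0 < m"
  shows "(\<integral>\<^sup>+x. ennreal (noise M z u m x \<bullet> noise M z u m x) \<partial>PiM {1..m} (\<lambda>_. \<sigma>))
    \<le> ennreal (3 * real CARD('n) / real m * (L2_norm \<mu> (residual u))\<^sup>2)"
proof -
  let ?g = "residual u"
  have g2: "integrable \<mu> (\<lambda>y. (?g y)\<^sup>2)" and [measurable]: "?g \<in> borel_measurable \<mu>"
    using residual_L2[OF u] by (auto simp: L2_space_def)
  define \<psi> where "\<psi> = (\<lambda>y. (w y * ?g y) *\<^sub>R feature L y)"
  have [measurable]: "\<psi> \<in> borel_measurable \<sigma>" unfolding \<psi>_def by measurable
  have comp: "\<psi> y $ j = w y * (?g y * L j y)" for y j by (simp add: \<psi>_def)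
  have zero: "?g y * L j y = 0" if "\<kappa> y = 0" for y j
    using feature_eq_0[OF that] feature_nth[of L y j] by simp
  have gL: "integrable \<mu> (\<lambda>y. ?g y * L j y)" for j
    by (rule integrable_L2_mult[OF residual_L2[OF u] L_L2])
  define h where "h = (\<lambda>y. w y * (feature L y \<bullet> feature L y) * (?g y)\<^sup>2)"
  have h_le: "0 \<le> h y" "h y \<le> 3 * real CARD('n) * (?g y)\<^sup>2" for y
    unfolding h_def using w_nonneg[of y] by (simp, intro mult_right_mono w_christoffel_le) simp
  have h: "integrable \<mu> h"
  proof (rule Bochner_Integration.integrable_bound)
    show "integrable \<mu> (\<lambda>y. 3 * real CARD('n) * (?g y)\<^sup>2)" using g2 by simp
    show "h \<in> borel_measurable \<mu>" unfolding h_def by measurable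
    show "AE y in \<mu>. norm (h y) \<le> norm (3 * real CARD('n) * (?g y)\<^sup>2)"
      using h_le by (intro AE_I2) simp
  qed
  have h0: "h y = 0" if "\<kappa> y = 0" for y
    using feature_eq_0[OF that] by (simp add: h_def)
  have \<psi>\<psi>: "\<psi> y \<bullet> \<psi> y = w y * h y" for y
    by (simp add: \<psi>_def h_def power2_eq_square mult_ac)
  have noise_eq: "noise M z u m x \<bullet> noise M z u m x =
      1 / (real m)\<^sup>2 * ((\<Sum>i\<in>{1..m}. \<psi> (x i)) \<bullet> (\<Sum>i\<in>{1..m}. \<psi> (x i)))" for x
    by (simp add: noise_def \<psi>_def power2_eq_square divide_inverse)
  have S: "(\<lambda>x. \<Sum>i\<in>{1..m}. \<psi> (x i)) \<in> borel_measurable (PiM {1..m} (\<lambda>_. \<sigma>))"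
    by (intro borel_measurable_sum) measurable
  have "(\<integral>\<^sup>+x. ennreal (noise M z u m x \<bullet> noise M z u m x) \<partial>PiM {1..m} (\<lambda>_. \<sigma>)) =
      (\<integral>\<^sup>+x. ennreal (1 / (real m)\<^sup>2) * ennreal ((\<Sum>i\<in>{1..m}. \<psi> (x i)) \<bullet> (\<Sum>i\<in>{1..m}. \<psi> (x i))) \<partial>PiM {1..m} (\<lambda>_. \<sigma>))"
    unfolding noise_eq by (intro nn_integral_cong ennreal_mult) auto
  also have "\<dots> = ennreal (1 / (real m)\<^sup>2) *
      (\<integral>\<^sup>+x. ennreal ((\<Sum>i\<in>{1..m}. \<psi> (x i)) \<bullet> (\<Sum>i\<in>{1..m}. \<psi> (x i))) \<partial>PiM {1..m} (\<lambda>_. \<sigma>))"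
    using S by (intro nn_integral_cmult) auto
  also have "\<dots> = ennreal (1 / (real m)\<^sup>2) * ennreal (real m * (\<integral>y. \<psi> y \<bullet> \<psi> y \<partial>\<sigma>))"
  proof (subst nn_integral_centred_sum[OF prob_sampling])
    show "integrable \<sigma> (\<lambda>y. \<psi> y $ j)" "(\<integral>y. \<psi> y $ j \<partial>\<sigma>) = 0" for j
      unfolding comp using integral_sampling[OF gL zero] integral_residual_L[OF u] by auto
    show "integrable \<sigma> (\<lambda>y. \<psi> y \<bullet> \<psi> y)"
      unfolding \<psi>\<psi> by (rule integral_sampling(1)[OF h h0])
  qed auto
  also have "(\<integral>y. \<psi> y \<bullet> \<psi> y \<partial>\<sigma>) = (\<integral>y. h y \<partial>\<mu>)"
    unfolding \<psi>\<psi> by (rule integral_sampling(2)[OF h h0])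
  also have "ennreal (1 / (real m)\<^sup>2) * ennreal (real m * (\<integral>y. h y \<partial>\<mu>)) = ennreal ((\<integral>y. h y \<partial>\<mu>) / real m)"
    using m h_le(1) by (subst ennreal_mult[symmetric]) (auto simp: power2_eq_square)
  also have "\<dots> \<le> ennreal (3 * real CARD('n) / real m * (L2_norm \<mu> (residual u))\<^sup>2)"
  proof (rule ennreal_leI)
    have "(\<integral>y. h y \<partial>\<mu>) \<le> (\<integral>y. 3 * real CARD('n) * (?g y)\<^sup>2 \<partial>\<mu>)"
      using h g2 h_le(2) by (intro integral_mono) auto
    also have "\<dots> = 3 * real CARD('n) * (L2_norm \<mu> (residual u))\<^sup>2"
      by (simp add: L2_norm_sq)
    finally show "(\<integral>y. h y \<partial>\<mu>) / real m \<le> 3 * real CARD('n) / real m * (L2_norm \<mu> (residual u))\<^sup>2"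
      by (simp add: divide_right_mono)
  qed
  finally show ?thesis .
qed

lemma least_squares_error:
  assumes u: "u \<in> L2_space \<mu>" and m: "0 < m"
    and online: "spectral_norm (online_gram M z m x - mat 1) \<le> 1/2"
    and argmin: "is_arg_min (\<lambda>v. \<Sum>i\<in>{1..m}. weight \<mu> Lt (x i) * \<bar>u (x i) - v (x i)\<bar>\<^sup>2) (\<lambda>v. v \<in> V) v"
  defines "d \<equiv> cramer_solve (online_gram M z m x) (noise M z u m x)"
  shows "(L2_norm \<mu> (\<lambda>y. u y - v y))\<^sup>2 = (L2_norm \<mu> (residual u))\<^sup>2 + d \<bullet> d"
    and "d \<bullet> d \<le> 4 * (noise M z u m x \<bullet> noise M z u m x)"
proof -
  have am: "v \<in> V \<and> (\<forall>v'. v' \<in> V \<longrightarrow>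
      (\<Sum>i\<in>{1..m}. w (x i) * (u (x i) - v (x i))\<^sup>2) \<le> (\<Sum>i\<in>{1..m}. w (x i) * (u (x i) - v' (x i))\<^sup>2))"
    using argmin unfolding weight_eq is_arg_min_linorder power2_abs .
  then have "v \<in> V" ..
  then obtain c where v: "v = (\<lambda>y. c \<bullet> feature L y)" using V_iff by blast
  have "online_gram M z m x *v (c - proj_coeff u) = noise M z u m x"
    unfolding noise_def online_gram_def
  proof (rule least_squares_coeff[OF _ m])
    fix c' show "(\<Sum>i\<in>{1..m}. w (x i) * (u (x i) - c \<bullet> feature L (x i))\<^sup>2)
        \<le> (\<Sum>i\<in>{1..m}. w (x i) * (u (x i) - c' \<bullet> feature L (x i))\<^sup>2)"
      using am V_iff unfolding v by blast
  qed (rule w_nonneg)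
  then have c: "c - proj_coeff u = d"
    unfolding d_def using cramer_solve_unique[OF det_nonzero_near_identity[OF online]] by blast
  show "(L2_norm \<mu> (\<lambda>y. u y - v y))\<^sup>2 = (L2_norm \<mu> (residual u))\<^sup>2 + d \<bullet> d"
    unfolding v L2_error_pythagoras[OF u] c ..
  have "online_gram M z m x *v d = noise M z u m x"
    unfolding d_def using cramer_solve_unique[OF det_nonzero_near_identity[OF online]] by blast
  then show "d \<bullet> d \<le> 4 * (noise M z u m x \<bullet> noise M z u m x)"
    by (rule near_identity_solution_bound[OF online])
qed

end


section \<open>The two-stage law\<close>

text \<open>
  The measure of a product set is a finite product of measurable functions of \<open>z\<close>, and product sets form
  an intersection-stable generator.
\<close>

lemma measurable_iid_samples:
  assumes \<sigma>: "\<sigma> \<in> N \<rightarrow>\<^sub>M prob_algebra \<mu>"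
  shows "(\<lambda>z. iid_samples m (\<sigma> z)) \<in> N \<rightarrow>\<^sub>M prob_algebra (iid_samples m \<mu>)"
  unfolding iid_samples_def
proof (rule measurable_prob_algebra_generated[OF sets_PiM Int_stable_prod_algebra prod_algebra_sets_into_space])
  have \<sigma>_z: "prob_space (\<sigma> z)" "sets (\<sigma> z) = sets \<mu>" if "z \<in> space N" for z
    using measurable_space[OF \<sigma> that] by (auto simp: space_prob_algebra)
  fix z assume z: "z \<in> space N"
  show "prob_space (PiM {1..m} (\<lambda>_. \<sigma> z))"
    by (intro prob_space_PiM \<sigma>_z z)
  show "sets (PiM {1..m} (\<lambda>_. \<sigma> z)) = sets (PiM {1..m} (\<lambda>_. \<mu>))"
    by (intro sets_PiM_cong refl \<sigma>_z z)
next
  have \<sigma>_z: "prob_space (\<sigma> z)" "sets (\<sigma> z) = sets \<mu>" if "z \<in> space N" for z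
    using measurable_space[OF \<sigma> that] by (auto simp: space_prob_algebra)
  fix A assume "A \<in> prod_algebra {1..m} (\<lambda>_. \<mu>)"
  then obtain X where A: "A = (\<Pi>\<^sub>E i\<in>{1..m}. X i)" and "X \<in> {1..m} \<rightarrow> sets \<mu>"
    unfolding prod_algebra_eq_finite[OF finite_atLeastAtMost] by blast
  then have X: "X i \<in> sets \<mu>" if "i \<in> {1..m}" for i
    using that by blast
  have "emeasure (PiM {1..m} (\<lambda>_. \<sigma> z)) A = (\<Prod>i\<in>{1..m}. emeasure (\<sigma> z) (X i))" if z: "z \<in> space N" for z
  proof -
    interpret prob_space "\<sigma> z" by (rule \<sigma>_z(1)[OF z])
    interpret P: product_sigma_finite "\<lambda>_::nat. \<sigma> z" by unfold_locales
    show ?thesis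
      unfolding A using X \<sigma>_z(2)[OF z] by (intro P.emeasure_PiM) auto
  qed
  moreover have "(\<lambda>z. \<Prod>i\<in>{1..m}. emeasure (\<sigma> z) (X i)) \<in> borel_measurable N"
    by (intro borel_measurable_prod_ennreal measurable_emeasure_kernel[OF measurable_prob_algebraD[OF \<sigma>]] X)
  ultimately show "(\<lambda>z. emeasure (PiM {1..m} (\<lambda>_. \<sigma> z)) A) \<in> borel_measurable N"
    by (simp cong: measurable_cong)
qed

lemma
  assumes \<mu>: "prob_space \<mu>" and \<sigma>: "\<sigma> \<in> iid_samples M \<mu> \<rightarrow>\<^sub>M prob_algebra \<mu>"
  shows sets_two_stage_law:
      "sets (two_stage_law \<mu> M m \<sigma>) = sets (iid_samples M \<mu> \<Otimes>\<^sub>M iid_samples m \<mu>)"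
    and nn_integral_two_stage_law:
      "h \<in> borel_measurable (iid_samples M \<mu> \<Otimes>\<^sub>M iid_samples m \<mu>) \<Longrightarrow>
        (\<integral>\<^sup>+\<omega>. h \<omega> \<partial>two_stage_law \<mu> M m \<sigma>) =
        (\<integral>\<^sup>+z. \<integral>\<^sup>+x. h (z, x) \<partial>iid_samples m (\<sigma> z) \<partial>iid_samples M \<mu>)"
proof -
  let ?N = "iid_samples M \<mu>" and ?N' = "iid_samples m \<mu>"
  interpret N: prob_space ?N
    unfolding iid_samples_def by (intro prob_space_PiM \<mu>)
  have ker: "(\<lambda>z. iid_samples m (\<sigma> z)) \<in> ?N \<rightarrow>\<^sub>M subprob_algebra ?N'"
    by (rule measurable_prob_algebraD[OF measurable_iid_samples[OF \<sigma>]])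
  have Q: "(\<lambda>z. distr (iid_samples m (\<sigma> z)) (?N \<Otimes>\<^sub>M ?N') (\<lambda>x. (z, x))) \<in> ?N \<rightarrow>\<^sub>M subprob_algebra (?N \<Otimes>\<^sub>M ?N')"
    by (rule measurable_distr2[OF _ ker]) simp
  show "sets (two_stage_law \<mu> M m \<sigma>) = sets (?N \<Otimes>\<^sub>M ?N')"
    unfolding two_stage_law_def by (rule sets_bind_measurable[OF Q N.not_empty])
  assume h: "h \<in> borel_measurable (?N \<Otimes>\<^sub>M ?N')"
  have "(\<integral>\<^sup>+\<omega>. h \<omega> \<partial>two_stage_law \<mu> M m \<sigma>) =
      (\<integral>\<^sup>+z. \<integral>\<^sup>+\<omega>. h \<omega> \<partial>distr (iid_samples m (\<sigma> z)) (?N \<Otimes>\<^sub>M ?N') (\<lambda>x. (z, x)) \<partial>?N)"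
    unfolding two_stage_law_def by (rule nn_integral_bind[OF h Q])
  also have "\<dots> = (\<integral>\<^sup>+z. \<integral>\<^sup>+x. h (z, x) \<partial>iid_samples m (\<sigma> z) \<partial>?N)"
  proof (rule nn_integral_cong)
    fix z assume z: "z \<in> space ?N"
    have sets: "sets (iid_samples m (\<sigma> z)) = sets ?N'"
      using measurable_space[OF measurable_iid_samples[OF \<sigma>] z] by (simp add: space_prob_algebra)
    have "Pair z \<in> iid_samples m (\<sigma> z) \<rightarrow>\<^sub>M ?N \<Otimes>\<^sub>M ?N'"
      using measurable_Pair1'[OF z, of ?N'] by (simp add: measurable_cong_sets[OF sets refl])
    then show "(\<integral>\<^sup>+\<omega>. h \<omega> \<partial>distr (iid_samples m (\<sigma> z)) (?N \<Otimes>\<^sub>M ?N') (\<lambda>x. (z, x))) =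
        (\<integral>\<^sup>+x. h (z, x) \<partial>iid_samples m (\<sigma> z))"
      using h by (intro nn_integral_distr) auto
  qed
  finally show "(\<integral>\<^sup>+\<omega>. h \<omega> \<partial>two_stage_law \<mu> M m \<sigma>) =
      (\<integral>\<^sup>+z. \<integral>\<^sup>+x. h (z, x) \<partial>iid_samples m (\<sigma> z) \<partial>?N)" .
qed

section \<open>Stability and accuracy of two-stage sampling\<close>

lemma trunc_bounds:
  assumes "\<bar>a\<bar> \<le> \<tau>"
  shows "\<bar>a - trunc \<tau> b\<bar> \<le> \<bar>a - b\<bar>" "\<bar>a - trunc \<tau> b\<bar> \<le> 2 * \<tau>"
  using assms by (auto simp: trunc_def min_def sgn_if abs_if split: if_splits)

locale two_stage_sampling = orthonormal_system \<mu> V L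
  for \<mu> :: "'a measure" and V and L :: "'n::finite \<Rightarrow> 'a \<Rightarrow> real" +
  fixes M m :: nat and Lt :: "(nat \<Rightarrow> 'a) \<Rightarrow> 'n \<Rightarrow> 'a \<Rightarrow> real" and \<sigma> :: "(nat \<Rightarrow> 'a) \<Rightarrow> 'a measure"
    and \<epsilon> B :: real
  assumes offline: "offline_basis \<mu> V M Lt"
    and kernel: "online_kernel \<mu> V M Lt \<sigma>"
    and \<epsilon>: "0 < \<epsilon>" "\<epsilon> < 1"
    and christoffel_le: "\<And>y. y \<in> space \<mu> \<Longrightarrow> christoffel L y \<le> B"
    and M_ge: "real M \<ge> gamma_const * B * ln (2 * real CARD('n) / \<epsilon>)"
    and m_ge: "real m \<ge> 3 * gamma_const * real CARD('n) * ln (2 * real CARD('n) / \<epsilon>)"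
begin

abbreviation "N \<equiv> iid_samples M \<mu>"
abbreviation "N' \<equiv> iid_samples m \<mu>"
abbreviation "P \<equiv> two_stage_law \<mu> M m \<sigma>"
abbreviation "E \<equiv> stable_event \<mu> M m L Lt"

lemma ln_budget_pos: "0 < ln (2 * real CARD('n) / \<epsilon>)"
  and m_pos: "0 < m"
proof -
  have "1 \<le> real CARD('n)" by (simp add: Suc_leI)
  then have "\<epsilon> < 2 * real CARD('n)" using \<epsilon> by linarith
  then show ln: "0 < ln (2 * real CARD('n) / \<epsilon>)" using \<epsilon> by simp
  then have pos: "0 < 3 * gamma_const * real CARD('n) * ln (2 * real CARD('n) / \<epsilon>)"
    using gamma_const_pos by simp
  show "0 < m" using less_le_trans[OF pos m_ge] by simp
qed

lemma prob_N: "prob_space N"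
  unfolding iid_samples_def by (intro prob_space_PiM prob_space_axioms)

lemma \<sigma>_kernel: "\<sigma> \<in> N \<rightarrow>\<^sub>M prob_algebra \<mu>"
  using kernel by (simp add: online_kernel_def)

lemma prob_online: "z \<in> space N \<Longrightarrow> prob_space (iid_samples m (\<sigma> z))"
  and sets_online: "z \<in> space N \<Longrightarrow> sets (iid_samples m (\<sigma> z)) = sets N'"
  and space_online: "z \<in> space N \<Longrightarrow> space (iid_samples m (\<sigma> z)) = space N'"
proof -
  assume z: "z \<in> space N"
  show "prob_space (iid_samples m (\<sigma> z))" and s: "sets (iid_samples m (\<sigma> z)) = sets N'"
    using measurable_space[OF measurable_iid_samples[OF \<sigma>_kernel] z] by (auto simp: space_prob_algebra)
  show "space (iid_samples m (\<sigma> z)) = space N'"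
    by (rule sets_eq_imp_space_eq[OF s])
qed

lemma sets_P [measurable_cong]: "sets P = sets (N \<Otimes>\<^sub>M N')"
  by (rule sets_two_stage_law[OF prob_space_axioms \<sigma>_kernel])

lemma space_P: "space P = space N \<times> space N'"
  using sets_eq_imp_space_eq[OF sets_P] by (simp add: space_pair_measure)

lemma online_stageI:
  assumes z: "z \<in> space N" and "offline_stable M z"
  shows "online_stage \<mu> V L M z (Lt z)" and "\<sigma> z = sampling_measure \<mu> (Lt z)"
proof -
  have ip: "inner_product_on V (offline_ip M z)"
    by (rule offline_stable_inner_product) fact
  show eq: "\<sigma> z = sampling_measure \<mu> (Lt z)"
    using kernel z ip by (simp add: online_kernel_def)
  have "prob_space (\<sigma> z)"
    using measurable_space[OF \<sigma>_kernel z] by (simp add: space_prob_algebra)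
  moreover have "orthonormal_basis (offline_ip M z) V (Lt z)"
    using offline z ip unfolding offline_basis_def by blast
  ultimately show "online_stage \<mu> V L M z (Lt z)"
    unfolding eq
    by (intro online_stage.intro online_stage_axioms.intro orthonormal_system_axioms assms)
qed

text \<open>
  On offline-stable samples the given weight equals the measurable one built from the Gram matrix, so
  the stable event can be described without reference to the chosen bases; its measurability rests on this.
\<close>

lemma E_iff:
  "(z, x) \<in> E \<longleftrightarrow> z \<in> space N \<and> x \<in> space N' \<and> offline_stable M z \<and>
     spectral_norm (online_gram M z m x - mat 1) \<le> 1/2"
proof (cases "z \<in> space N \<and> offline_stable M z")
  case True
  then interpret O: online_stage \<mu> V L M z "Lt z" using online_stageI by blast
  show ?thesis
    using True unfolding stable_event_def
    by (simp add: space_pair_measure O.gram_online_eq gram_offline_ip offline_stable_def)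
next
  case False
  then show ?thesis
    unfolding stable_event_def by (auto simp: space_pair_measure gram_offline_ip offline_stable_def)
qed

lemma measurable_sample [measurable]:
  "i \<in> {1..M} \<Longrightarrow> (\<lambda>z. z i) \<in> N \<rightarrow>\<^sub>M \<mu>" "i \<in> {1..m} \<Longrightarrow> (\<lambda>x. x i) \<in> N' \<rightarrow>\<^sub>M \<mu>"
  unfolding iid_samples_def by (simp_all add: measurable_component_singleton)

lemma empirical_gram_measurable [measurable]: "(\<lambda>z. empirical_gram M z) \<in> borel_measurable N"
  by (intro borel_measurable_second_moment measurable_compose[OF _ feature_measurable] measurable_sample)

lemma empirical_christoffel_measurable [measurable]:
  "(\<lambda>(z, y). empirical_christoffel M z y) \<in> borel_measurable (N \<Otimes>\<^sub>M \<mu>)"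
  unfolding empirical_christoffel_def by measurable

lemma empirical_weight_measurable [measurable]:
  "(\<lambda>(z, y). empirical_weight M z y) \<in> borel_measurable (N \<Otimes>\<^sub>M \<mu>)"
proof -
  have [measurable]: "(\<lambda>z. \<integral>y. empirical_christoffel M z y \<partial>\<mu>) \<in> borel_measurable N"
    by (rule borel_measurable_lebesgue_integral) (rule empirical_christoffel_measurable)
  show ?thesis
    unfolding empirical_weight_def by measurable
qed

lemma online_weight_measurable:
  assumes "i \<in> {1..m}"
  shows "(\<lambda>\<omega>. empirical_weight M (fst \<omega>) (snd \<omega> i)) \<in> borel_measurable (N \<Otimes>\<^sub>M N')"
proof -
  have "(\<lambda>\<omega>. (fst \<omega>, snd \<omega> i)) \<in> N \<Otimes>\<^sub>M N' \<rightarrow>\<^sub>M N \<Otimes>\<^sub>M \<mu>"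
    using measurable_sample(2)[OF assms] by measurable
  from measurable_compose[OF this empirical_weight_measurable] show ?thesis by simp
qed

lemma online_feature_measurable:
  assumes "i \<in> {1..m}"
  shows "(\<lambda>\<omega>. feature L (snd \<omega> i)) \<in> borel_measurable (N \<Otimes>\<^sub>M N')"
  using measurable_compose[OF measurable_compose[OF measurable_snd measurable_sample(2)[OF assms]] feature_measurable] .

lemma online_gram_measurable [measurable]:
  "(\<lambda>\<omega>. online_gram M (fst \<omega>) m (snd \<omega>)) \<in> borel_measurable (N \<Otimes>\<^sub>M N')"
proof -
  have "(\<lambda>\<omega>. sqrt (empirical_weight M (fst \<omega>) (snd \<omega> i))) \<in> borel_measurable (N \<Otimes>\<^sub>M N')"
    if "i \<in> {1..m}" for i
    using online_weight_measurable[OF that] by measurable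
  then show ?thesis
    unfolding online_gram_def
    by (intro borel_measurable_second_moment borel_measurable_scaleR online_feature_measurable)
qed

lemma noise_joint_measurable:
  assumes u: "u \<in> L2_space \<mu>"
  shows "(\<lambda>\<omega>. noise M (fst \<omega>) u m (snd \<omega>)) \<in> borel_measurable (N \<Otimes>\<^sub>M N')"
proof -
  have g: "residual u \<in> borel_measurable \<mu>"
    using residual_L2[OF u] by (simp add: L2_space_def)
  have "(\<lambda>\<omega>. residual u (snd \<omega> i)) \<in> borel_measurable (N \<Otimes>\<^sub>M N')" if "i \<in> {1..m}" for i
    using measurable_compose[OF measurable_compose[OF measurable_snd measurable_sample(2)[OF that]] g] .
  then show ?thesis
    unfolding noise_def
    by (intro borel_measurable_scaleR borel_measurable_const borel_measurable_sum borel_measurable_times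
        online_weight_measurable online_feature_measurable)
qed

lemma E_measurable: "E \<in> sets (N \<Otimes>\<^sub>M N')"
proof -
  have "E = {\<omega> \<in> space (N \<Otimes>\<^sub>M N'). spectral_norm (empirical_gram M (fst \<omega>) - mat 1) \<le> 1/2 \<and>
      spectral_norm (online_gram M (fst \<omega>) m (snd \<omega>) - mat 1) \<le> 1/2}"
    using E_iff by (auto simp: space_pair_measure offline_stable_def)
  also have "\<dots> \<in> sets (N \<Otimes>\<^sub>M N')" by measurable
  finally show ?thesis .
qed

lemma offline_unstable_le: "emeasure N {z \<in> space N. \<not> offline_stable M z} \<le> ennreal \<epsilon>"
  unfolding offline_stable_def iid_samples_def
proof (rule matrix_chernoff[OF prob_space_axioms feature_measurable])
  show "feature L y \<bullet> feature L y \<le> B" if "y \<in> space \<mu>" for y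
    using christoffel_le[OF that] by (simp add: christoffel_eq)
qed (simp_all add: integral_L_mult \<epsilon> M_ge)

lemma online_unstable_le:
  assumes z: "z \<in> space N" and stable: "offline_stable M z"
  shows "emeasure (iid_samples m (\<sigma> z)) {x \<in> space N'. (z, x) \<notin> E} \<le> ennreal \<epsilon>"
proof -
  interpret O: online_stage \<mu> V L M z "Lt z" by (rule online_stageI[OF assms])
  have eq: "{x \<in> space N'. (z, x) \<notin> E} =
      {x \<in> space (iid_samples m (\<sigma> z)). \<not> spectral_norm (online_gram M z m x - mat 1) \<le> 1/2}"
    using assms by (auto simp: E_iff space_online)
  show ?thesis
    unfolding eq using O.online_chernoff[OF \<epsilon> m_ge]
    by (simp add: online_stageI(2)[OF assms] iid_samples_def)
qed

text \<open>
  Conditionally on \<open>z\<close>, the failure probability is at most \<open>1\<close> for an unstable offline sample and at most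
  \<open>\<epsilon>\<close> for a stable one.
\<close>

lemma unstable_le: "emeasure P (space P - E) \<le> ennreal (2 * \<epsilon>)"
proof -
  interpret N: prob_space N by (rule prob_N)
  let ?A = "space (N \<Otimes>\<^sub>M N') - E" and ?B = "{z \<in> space N. \<not> offline_stable M z}"
  have A [measurable]: "?A \<in> sets (N \<Otimes>\<^sub>M N')" using E_measurable by auto
  have B [measurable]: "?B \<in> sets N" unfolding offline_stable_def by measurable
  have "emeasure P ?A = (\<integral>\<^sup>+\<omega>. indicator ?A \<omega> \<partial>P)"
    using A by (intro nn_integral_indicator[symmetric]) (simp add: sets_P)
  also have "\<dots> = (\<integral>\<^sup>+z. \<integral>\<^sup>+x. indicator ?A (z, x) \<partial>iid_samples m (\<sigma> z) \<partial>N)"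
    using A by (intro nn_integral_two_stage_law[OF prob_space_axioms \<sigma>_kernel]) auto
  also have "\<dots> \<le> (\<integral>\<^sup>+z. indicator ?B z + ennreal \<epsilon> \<partial>N)"
  proof (rule nn_integral_mono)
    fix z assume z: "z \<in> space N"
    interpret O: prob_space "iid_samples m (\<sigma> z)" by (rule prob_online[OF z])
    have "(\<integral>\<^sup>+x. indicator ?A (z, x) \<partial>iid_samples m (\<sigma> z)) =
        (\<integral>\<^sup>+x. indicator (Pair z -` ?A) x \<partial>iid_samples m (\<sigma> z))"
      by (intro nn_integral_cong) (auto simp: indicator_def)
    also have "\<dots> = emeasure (iid_samples m (\<sigma> z)) (Pair z -` ?A)"
      using sets_Pair1[OF A, of z] by (intro nn_integral_indicator) (simp add: sets_online[OF z])
    also have "\<dots> \<le> indicator ?B z + ennreal \<epsilon>"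
    proof (cases "offline_stable M z")
      case True
      have "Pair z -` ?A = {x \<in> space N'. (z, x) \<notin> E}"
        using z by (auto simp: space_pair_measure)
      then show ?thesis
        using online_unstable_le[OF z True] by (simp add: add_increasing)
    next
      case False
      have "emeasure (iid_samples m (\<sigma> z)) (Pair z -` ?A) \<le> 1" by (rule O.emeasure_le_1)
      also have "\<dots> \<le> indicator ?B z + ennreal \<epsilon>" using False z by simp
      finally show ?thesis .
    qed
    finally show "(\<integral>\<^sup>+x. indicator ?A (z, x) \<partial>iid_samples m (\<sigma> z)) \<le> indicator ?B z + ennreal \<epsilon>" .
  qed
  also have "\<dots> = emeasure N ?B + ennreal \<epsilon>"
    using B by (simp add: nn_integral_add N.emeasure_space_1)
  also have "\<dots> \<le> ennreal \<epsilon> + ennreal \<epsilon>"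
    by (intro add_right_mono offline_unstable_le)
  also have "\<dots> = ennreal (2 * \<epsilon>)" using \<epsilon> by (simp flip: ennreal_plus)
  finally show ?thesis by (simp add: space_P space_pair_measure)
qed

text \<open>
  The squared error of the estimator on the stable event, where the data determine it.  By Cramer's rule
  the formula is measurable in the samples.
\<close>

definition squared_error :: "('a \<Rightarrow> real) \<Rightarrow> (nat \<Rightarrow> 'a) \<times> (nat \<Rightarrow> 'a) \<Rightarrow> real" where
  "squared_error u \<omega> = (L2_norm \<mu> (residual u))\<^sup>2 +
     (let d = cramer_solve (online_gram M (fst \<omega>) m (snd \<omega>)) (noise M (fst \<omega>) u m (snd \<omega>)) in d \<bullet> d)"

lemma squared_error_measurable:
  assumes u: "u \<in> L2_space \<mu>"
  shows "squared_error u \<in> borel_measurable (N \<Otimes>\<^sub>M N')"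
proof -
  note [measurable] = noise_joint_measurable[OF u]
  show ?thesis unfolding squared_error_def[abs_def] Let_def by measurable
qed

lemma estimator_error:
  assumes u: "u \<in> L2_space \<mu>" and ut: "least_squares_estimator \<mu> V M m Lt u ut" and \<omega>: "(z, x) \<in> E"
  shows "(L2_norm \<mu> (\<lambda>y. u y - ut (z, x) y))\<^sup>2 = squared_error u (z, x)"
    and "squared_error u (z, x) \<le> (L2_norm \<mu> (residual u))\<^sup>2 + 4 * (noise M z u m x \<bullet> noise M z u m x)"
proof -
  have z: "z \<in> space N" and x: "x \<in> space N'" and st: "offline_stable M z"
    and on: "spectral_norm (online_gram M z m x - mat 1) \<le> 1/2"
    using \<omega> by (auto simp: E_iff)
  interpret O: online_stage \<mu> V L M z "Lt z" by (rule online_stageI[OF z st])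
  have am: "is_arg_min (\<lambda>v. \<Sum>i\<in>{1..m}. weight \<mu> (Lt z) (x i) * \<bar>u (x i) - v (x i)\<bar>\<^sup>2) (\<lambda>v. v \<in> V) (ut (z, x))"
    using ut z x offline_stable_inner_product[OF st] unfolding least_squares_estimator_def by blast
  show "(L2_norm \<mu> (\<lambda>y. u y - ut (z, x) y))\<^sup>2 = squared_error u (z, x)"
    using O.least_squares_error(1)[OF u m_pos on am] by (simp add: squared_error_def Let_def)
  show "squared_error u (z, x) \<le> (L2_norm \<mu> (residual u))\<^sup>2 + 4 * (noise M z u m x \<bullet> noise M z u m x)"
    using O.least_squares_error(2)[OF u m_pos on am] by (simp add: squared_error_def Let_def)
qed

text \<open>
  Conditionally on \<open>z\<close>: an unstable offline sample contributes nothing, and a stable one at most the squared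
  residual norm plus four times the expected squared noise.
\<close>

lemma expected_error:
  assumes u: "u \<in> L2_space \<mu>" and ut: "least_squares_estimator \<mu> V M m Lt u ut"
  shows "(\<lambda>\<omega>. (L2_norm \<mu> (\<lambda>y. u y - ut \<omega> y))\<^sup>2 * indicator E \<omega>) \<in> borel_measurable P"
    and "(\<integral>\<^sup>+\<omega>. ennreal ((L2_norm \<mu> (\<lambda>y. u y - ut \<omega> y))\<^sup>2 * indicator E \<omega>) \<partial>P)
      \<le> ennreal ((1 + 12 * (real CARD('n) / real m)) * (best_error \<mu> V u)\<^sup>2)"
proof -
  interpret N: prob_space N by (rule prob_N)
  let ?f = "\<lambda>\<omega>. (L2_norm \<mu> (\<lambda>y. u y - ut \<omega> y))\<^sup>2 * indicator E \<omega>"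
  let ?r = "(L2_norm \<mu> (residual u))\<^sup>2"
  have f_eq: "?f = (\<lambda>\<omega>. squared_error u \<omega> * indicator E \<omega>)"
  proof
    fix \<omega> show "?f \<omega> = squared_error u \<omega> * indicator E \<omega>"
      using estimator_error(1)[OF u ut, of "fst \<omega>" "snd \<omega>"] by (cases "\<omega> \<in> E") simp_all
  qed
  have f_meas: "?f \<in> borel_measurable (N \<Otimes>\<^sub>M N')"
    unfolding f_eq using squared_error_measurable[OF u] E_measurable
    by (intro borel_measurable_times borel_measurable_indicator)
  then show "?f \<in> borel_measurable P"
    by (simp add: measurable_cong_sets[OF sets_P refl])
  have inner: "(\<integral>\<^sup>+x. ennreal (?f (z, x)) \<partial>iid_samples m (\<sigma> z)) \<le> ennreal ((1 + 12 * (real CARD('n) / real m)) * ?r)"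
    if z: "z \<in> space N" for z
  proof (cases "offline_stable M z")
    case False
    then have "(z, x) \<notin> E" for x by (simp add: E_iff)
    then show ?thesis by simp
  next
    case True
    interpret O: online_stage \<mu> V L M z "Lt z" by (rule online_stageI[OF z True])
    interpret Q: prob_space "iid_samples m (\<sigma> z)" by (rule prob_online[OF z])
    have Q_eq: "iid_samples m (\<sigma> z) = PiM {1..m} (\<lambda>_. sampling_measure \<mu> (Lt z))"
      by (simp add: iid_samples_def online_stageI(2)[OF z True])
    have noise [measurable]: "noise M z u m \<in> borel_measurable (iid_samples m (\<sigma> z))"
      unfolding Q_eq by (rule O.noise_measurable[OF u])
    have "(\<integral>\<^sup>+x. ennreal (?f (z, x)) \<partial>iid_samples m (\<sigma> z))
        \<le> (\<integral>\<^sup>+x. ennreal ?r + 4 * ennreal (noise M z u m x \<bullet> noise M z u m x) \<partial>iid_samples m (\<sigma> z))"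
    proof (rule nn_integral_mono)
      fix x
      have "?f (z, x) \<le> ?r + 4 * (noise M z u m x \<bullet> noise M z u m x)"
        using estimator_error[OF u ut, of z x] by (cases "(z, x) \<in> E") simp_all
      then have "ennreal (?f (z, x)) \<le> ennreal (?r + 4 * (noise M z u m x \<bullet> noise M z u m x))"
        by (rule ennreal_leI)
      then show "ennreal (?f (z, x)) \<le> ennreal ?r + 4 * ennreal (noise M z u m x \<bullet> noise M z u m x)"
        by (simp add: ennreal_plus ennreal_mult)
    qed
    also have "\<dots> = ennreal ?r + 4 * (\<integral>\<^sup>+x. ennreal (noise M z u m x \<bullet> noise M z u m x) \<partial>iid_samples m (\<sigma> z))"
      by (simp add: nn_integral_add nn_integral_cmult Q.emeasure_space_1)
    also have "\<dots> \<le> ennreal ?r + 4 * ennreal (3 * real CARD('n) / real m * ?r)"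
      unfolding Q_eq by (intro add_left_mono mult_left_mono O.expected_noise[OF u m_pos]) simp
    also have "4 * ennreal (3 * real CARD('n) / real m * ?r) = ennreal (4 * (3 * real CARD('n) / real m * ?r))"
      by (subst (2) ennreal_mult) auto
    also have "ennreal ?r + \<dots> = ennreal ((1 + 12 * (real CARD('n) / real m)) * ?r)"
      by (subst ennreal_plus[symmetric]) (auto simp: algebra_simps)
    finally show ?thesis .
  qed
  have "(\<integral>\<^sup>+\<omega>. ennreal (?f \<omega>) \<partial>P) = (\<integral>\<^sup>+z. \<integral>\<^sup>+x. ennreal (?f (z, x)) \<partial>iid_samples m (\<sigma> z) \<partial>N)"
    using f_meas by (intro nn_integral_two_stage_law[OF prob_space_axioms \<sigma>_kernel]) auto
  also have "\<dots> \<le> (\<integral>\<^sup>+z. ennreal ((1 + 12 * (real CARD('n) / real m)) * ?r) \<partial>N)"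
    by (intro nn_integral_mono inner)
  also have "\<dots> = ennreal ((1 + 12 * (real CARD('n) / real m)) * ?r)" by (simp add: N.emeasure_space_1)
  also have "\<dots> \<le> ennreal ((1 + 12 * (real CARD('n) / real m)) * (best_error \<mu> V u)\<^sup>2)"
    using residual_le_best_error[OF u] L2_norm_nonneg
    by (intro ennreal_leI mult_left_mono power_mono) auto
  finally show "(\<integral>\<^sup>+\<omega>. ennreal (?f \<omega>) \<partial>P) \<le> ennreal ((1 + 12 * (real CARD('n) / real m)) * (best_error \<mu> V u)\<^sup>2)" .
qed

text \<open>
  Outside the stable event the estimator may depend on the samples in a non-measurable way.  The truncated
  error is therefore compared pointwise with a measurable function: the error of the estimator on the stable
  event and the constant \<open>4 \<tau>\<^sup>2\<close> elsewhere.
\<close>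

lemma expected_truncated_error:
  assumes u: "u \<in> L2_space \<mu>" and ut: "least_squares_estimator \<mu> V M m Lt u ut"
    and \<tau>: "0 < \<tau>" and u_le: "esssup \<mu> (\<lambda>y. ereal \<bar>u y\<bar>) \<le> ereal \<tau>"
  shows "(\<integral>\<^sup>+\<omega>. ennreal ((L2_norm \<mu> (\<lambda>y. u y - trunc \<tau> (ut \<omega> y)))\<^sup>2) \<partial>P)
      \<le> ennreal ((1 + 12 * (real CARD('n) / real m)) * (best_error \<mu> V u)\<^sup>2 + 8 * \<epsilon> * \<tau>\<^sup>2)"
proof -
  have bounded: "AE y in \<mu>. \<bar>u y\<bar> \<le> \<tau>"
    using esssup_AE[of "\<lambda>y. ereal \<bar>u y\<bar>" \<mu>]
    by eventually_elim (metis u_le ereal_less_eq(3) order_trans)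
  let ?f = "\<lambda>\<omega>. (L2_norm \<mu> (\<lambda>y. u y - ut \<omega> y))\<^sup>2 * indicator E \<omega>"
  let ?A = "space P - E"
  have A: "?A \<in> sets P" by (rule sets.compl_sets) (simp only: sets_P E_measurable)
  have pointwise: "(L2_norm \<mu> (\<lambda>y. u y - trunc \<tau> (ut \<omega> y)))\<^sup>2 \<le> ?f \<omega> + 4 * \<tau>\<^sup>2 * indicator ?A \<omega>"
    if \<omega>: "\<omega> \<in> space P" for \<omega>
  proof -
    have "ut \<omega> \<in> V"
      using ut \<omega> unfolding least_squares_estimator_def space_P by (cases \<omega>) auto
    then have utL2: "ut \<omega> \<in> L2_space \<mu>" using V_L2 by blast
    have [measurable]: "u \<in> borel_measurable \<mu>" "ut \<omega> \<in> borel_measurable \<mu>"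
      using u utL2 by (auto simp: L2_space_def)
    have meas [measurable]: "(\<lambda>y. (u y - trunc \<tau> (ut \<omega> y))\<^sup>2) \<in> borel_measurable \<mu>"
      unfolding trunc_def by measurable
    have sq_le: "AE y in \<mu>. (u y - trunc \<tau> (ut \<omega> y))\<^sup>2 \<le> (u y - ut \<omega> y)\<^sup>2"
      using bounded by eventually_elim (simp add: abs_le_square_iff[symmetric] trunc_bounds)
    have sq_le': "AE y in \<mu>. (u y - trunc \<tau> (ut \<omega> y))\<^sup>2 \<le> 4 * \<tau>\<^sup>2"
      using bounded
    proof eventually_elim
      case (elim y)
      have "\<bar>u y - trunc \<tau> (ut \<omega> y)\<bar>\<^sup>2 \<le> (2 * \<tau>)\<^sup>2"
        by (intro power_mono trunc_bounds(2) elim) auto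
      then show ?case by (simp add: power_mult_distrib)
    qed
    show ?thesis
    proof (cases "\<omega> \<in> E")
      case True
      have int: "integrable \<mu> (\<lambda>y. (u y - ut \<omega> y)\<^sup>2)"
        using L2_space_diff[OF u utL2] by (simp add: L2_space_def)
      have "(\<integral>y. (u y - trunc \<tau> (ut \<omega> y))\<^sup>2 \<partial>\<mu>) \<le> (\<integral>y. (u y - ut \<omega> y)\<^sup>2 \<partial>\<mu>)"
        by (rule integral_mono_AE[OF Bochner_Integration.integrable_bound[OF int meas] int sq_le])
           (use sq_le in auto)
      then show ?thesis using True by (simp add: L2_norm_sq)
    next
      case False
      have "(\<integral>y. (u y - trunc \<tau> (ut \<omega> y))\<^sup>2 \<partial>\<mu>) \<le> (\<integral>y. 4 * \<tau>\<^sup>2 \<partial>\<mu>)"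
        by (rule integral_mono_AE[OF integrable_const_bound[OF _ meas] integrable_const sq_le'])
           (use sq_le' in auto)
      then show ?thesis using False \<omega> by (simp add: L2_norm_sq prob_space)
    qed
  qed
  have "(\<integral>\<^sup>+\<omega>. ennreal ((L2_norm \<mu> (\<lambda>y. u y - trunc \<tau> (ut \<omega> y)))\<^sup>2) \<partial>P)
      \<le> (\<integral>\<^sup>+\<omega>. ennreal (?f \<omega>) + ennreal (4 * \<tau>\<^sup>2) * indicator ?A \<omega> \<partial>P)"
  proof (rule nn_integral_mono)
    fix \<omega> assume "\<omega> \<in> space P"
    from ennreal_leI[OF pointwise[OF this]]
    show "ennreal ((L2_norm \<mu> (\<lambda>y. u y - trunc \<tau> (ut \<omega> y)))\<^sup>2) \<le>
        ennreal (?f \<omega>) + ennreal (4 * \<tau>\<^sup>2) * indicator ?A \<omega>"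
      by (cases "\<omega> \<in> ?A") (auto simp: ennreal_plus)
  qed
  also have "\<dots> = (\<integral>\<^sup>+\<omega>. ennreal (?f \<omega>) \<partial>P) + ennreal (4 * \<tau>\<^sup>2) * emeasure P ?A"
    using expected_error(1)[OF u ut] A by (simp add: nn_integral_add nn_integral_cmult_indicator)
  also have "\<dots> \<le> ennreal ((1 + 12 * (real CARD('n) / real m)) * (best_error \<mu> V u)\<^sup>2) + ennreal (4 * \<tau>\<^sup>2) * ennreal (2 * \<epsilon>)"
    by (intro add_mono mult_left_mono expected_error(2)[OF u ut] unstable_le) simp
  also have "\<dots> = ennreal ((1 + 12 * (real CARD('n) / real m)) * (best_error \<mu> V u)\<^sup>2 + 8 * \<epsilon> * \<tau>\<^sup>2)"
    using \<epsilon> by (simp add: ennreal_mult[symmetric] ennreal_plus[symmetric] mult_ac del: ennreal_plus)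
  finally show ?thesis .
qed

lemma excess_le: "12 * (real CARD('n) / real m) \<le> 4 / (gamma_const * ln (2 * real CARD('n) / \<epsilon>))"
proof -
  have "0 < gamma_const * ln (2 * real CARD('n) / \<epsilon>)"
    using gamma_const_pos ln_budget_pos by simp
  then show ?thesis
    using m_ge m_pos by (simp add: field_simps)
qed

end

theorem corollary3p3:
  fixes D :: "'a::euclidean_space set"
    and \<mu> :: "'a measure"
    and V :: "('a \<Rightarrow> real) set"
    and L :: "'n::finite \<Rightarrow> 'a \<Rightarrow> real"
    and Lt :: "(nat \<Rightarrow> 'a) \<Rightarrow> 'n \<Rightarrow> 'a \<Rightarrow> real"
    and \<sigma> :: "(nat \<Rightarrow> 'a) \<Rightarrow> 'a measure"
    and n M m :: nat
    and \<epsilon> B :: real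
  defines "P \<equiv> two_stage_law \<mu> M m \<sigma>"
    and "E \<equiv> stable_event \<mu> M m L Lt"
    and "\<eta> \<equiv> 12 * (real n / real m)"
  assumes "prob_space \<mu>" and "sets \<mu> = sets (restrict_space borel D)"
    and "n = CARD('n)"
    and "V \<subseteq> L2_space \<mu>"
    and "orthonormal_basis (L2_inner \<mu>) V L"
    and "offline_basis \<mu> V M Lt"
    and "online_kernel \<mu> V M Lt \<sigma>"
    and "0 < \<epsilon>" and "\<epsilon> < 1"
    and "(SUP x\<in>D. ereal (christoffel L x)) \<le> ereal B"
    and "real M \<ge> gamma_const * B * ln (2 * real n / \<epsilon>)"
    and "real m \<ge> 3 * gamma_const * real n * ln (2 * real n / \<epsilon>)"
  shows "E \<in> sets P \<and> measure P (space P - E) \<le> 2 * \<epsilon>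
    \<and> \<eta> \<le> 4 / (gamma_const * ln (2 * real n / \<epsilon>))
    \<and> (\<forall>u ut. u \<in> L2_space \<mu> \<longrightarrow> least_squares_estimator \<mu> V M m Lt u ut \<longrightarrow>
          (\<lambda>\<omega>. (L2_norm \<mu> (\<lambda>y. u y - ut \<omega> y))\<^sup>2 * indicator E \<omega>) \<in> borel_measurable P
        \<and> (\<integral>\<^sup>+\<omega>. ennreal ((L2_norm \<mu> (\<lambda>y. u y - ut \<omega> y))\<^sup>2 * indicator E \<omega>) \<partial>P)
            \<le> ennreal ((1 + \<eta>) * (best_error \<mu> V u)\<^sup>2)
        \<and> (\<forall>\<tau>>0. esssup \<mu> (\<lambda>y. ereal \<bar>u y\<bar>) \<le> ereal \<tau> \<longrightarrow>
              (\<integral>\<^sup>+\<omega>. ennreal ((L2_norm \<mu> (\<lambda>y. u y - trunc \<tau> (ut \<omega> y)))\<^sup>2) \<partial>P)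
                \<le> ennreal ((1 + \<eta>) * (best_error \<mu> V u)\<^sup>2 + 8 * \<epsilon> * \<tau>\<^sup>2)))"
proof -
  have space: "space \<mu> = D"
    using sets_eq_imp_space_eq[OF \<open>sets \<mu> = sets (restrict_space borel D)\<close>] by (simp add: space_restrict_space)
  interpret S: two_stage_sampling \<mu> V L M m Lt \<sigma> \<epsilon> B
  proof (intro two_stage_sampling.intro orthonormal_system.intro orthonormal_system_axioms.intro
      two_stage_sampling_axioms.intro)
    fix y assume "y \<in> space \<mu>"
    then have "ereal (christoffel L y) \<le> (SUP x\<in>D. ereal (christoffel L x))"
      by (intro SUP_upper) (simp add: space)
    also have "\<dots> \<le> ereal B" by fact
    finally show "christoffel L y \<le> B" by simp
  qed (use assms in simp_all)
  have "emeasure P (space P - E) \<le> ennreal (2 * \<epsilon>)"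
    unfolding P_def E_def by (rule S.unstable_le)
  then have "measure P (space P - E) \<le> 2 * \<epsilon>"
    using \<open>0 < \<epsilon>\<close> enn2real_mono[of "emeasure P (space P - E)" "ennreal (2 * \<epsilon>)"]
    by (simp add: measure_def)
  moreover have "E \<in> sets P"
    unfolding P_def E_def S.sets_P by (rule S.E_measurable)
  ultimately show ?thesis
    using S.excess_le S.expected_error S.expected_truncated_error
    unfolding P_def E_def \<eta>_def \<open>n = CARD('n)\<close> by blast
qed

end
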